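(* Let $n\ge1$ and $N\ge 1$ be integers, let $\alpha\in(0,2)$, and let $p_i,q_i,r_i,s_i\ge1$ be real numbers for $i=1,\dots,N$. Let $u,v\in L_\alpha\cap C^{1,1}_{loc}(\mathbb{R}^n)$ be a positive solution of the system $$(-\Delta)^{\alpha/2}u(x)=\sum_{i=1}^N u(x)^{p_i}v(x)^{q_i},\quad (-\Delta)^{\alpha/2}v(x)=\sum_{i=1}^N u(x)^{r_i}v(x)^{s_i},\quad u(x)>0,\ v(x)>0,\qquad x\in\mathbb{R}^n.$$ Let $p=\min_{1\le i\le N}p_i$, $q=\min_{1\le i\le N}q_i$, $r=\min_{1\le i\le N}r_i$, $s=\min_{1\le i\le N}s_i$. Suppose that for some $a,b>0$: $u(x)\lesssim|x|^{-a}$ and $v(x)\lesssim|x|^{-b}$ as $|x|\to\infty$; and $\alpha<\min\{ap+bq-a,\ ap+bq-b,\ ar+bs-a,\ ar+bs-b\}$. Then there exists a point $x_0\in\mathbb{R}^n$ such that both $u$ and $v$ are radially symmetric about $x_0$, i.e. $u(x)$ and $v(x)$ depend only on $|x-x_0|$.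
   Context: For $\alpha\in(0,2)$, the fractional Laplacian is $$(-\Delta)^{\alpha/2}u(x)=C_{n,\alpha}\lim_{\epsilon\to0}\int_{\mathbb{R}^n\setminus B_\epsilon(x)}\frac{u(x)-u(y)}{|x-y|^{n+\alpha}}\,dy,$$ where $C_{n,\alpha}>0$ is a normalization constant. $L_\alpha$ is the set of functions $u:\mathbb{R}^n\to\mathbb{R}$ with $\int_{\mathbb{R}^n}\frac{|u(x)|}{1+|x|^{n+\alpha}}dx<+\infty$. $C^{1,1}_{loc}(\mathbb{R}^n)$ is the set of $C^1$ functions with locally Lipschitz gradient. For $u\in L_\alpha\cap C^{1,1}_{loc}(\mathbb{R}^n)$ the limit as $\epsilon\to0$ defining $(-\Delta)^{\alpha/2}u(x)$ is well defined at every point, and equations are understood pointwise. The notation $u(x)\lesssim|x|^{-a}$ as $|x|\to\infty$ means there is $R>0$ with $u(x)\le|x|^{-a}$ for all $|x|>R$. *)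

theory Defs
  imports "HOL-Analysis.Analysis"
begin

text \<open>The positive normalization constant is a parameter \<open>C\<close>.
  \<^const>\<open>Lim\<close> is total: its value is the limit whenever the limit exists.\<close>

definition frac_laplacian ::
  "real \<Rightarrow> real \<Rightarrow> (real ^ 'n \<Rightarrow> real) \<Rightarrow> real ^ 'n \<Rightarrow> real" where
  "frac_laplacian C \<alpha> u x =
     C * Lim (at_right 0)
       (\<lambda>\<epsilon>. LINT y : - ball x \<epsilon> | lebesgue.
               (u x - u y) / norm (x - y) powr (real CARD('n) + \<alpha>))"

definition L_space :: "real \<Rightarrow> (real ^ 'n \<Rightarrow> real) set" where
  "L_space \<alpha> = {u \<in> borel_measurable lebesgue.
     integrable lebesgue (\<lambda>x. \<bar>u x\<bar> / (1 + norm x powr (real CARD('n) + \<alpha>)))}"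

definition C11_loc :: "(real ^ 'n \<Rightarrow> real) set" where
  "C11_loc = {u. \<exists>g. (\<forall>x. GDERIV u x :> g x) \<and> continuous_on UNIV g \<and>
     (\<forall>x. \<exists>e>0. \<exists>L. L-lipschitz_on (ball x e) g)}"

text \<open>The bound \<open>u(x) \<lesssim> |x|\<^sup>-\<^sup>a\<close> at infinity, with
  implied constant equal to 1.\<close>

definition decays_at_infinity :: "(real ^ 'n \<Rightarrow> real) \<Rightarrow> real \<Rightarrow> bool" where
  "decays_at_infinity u a \<longleftrightarrow> (\<exists>R>0. \<forall>x. norm x > R \<longrightarrow> u x \<le> norm x powr (- a))"

definition radially_symmetric_about :: "(real ^ 'n \<Rightarrow> real) \<Rightarrow> real ^ 'n \<Rightarrow> bool" where
  "radially_symmetric_about u x0 \<longleftrightarrow> (\<exists>\<phi>. \<forall>x. u x = \<phi> (norm (x - x0)))"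

end

theory Submission
  imports Defs
begin

text \<open>
  The proof is the direct method of moving planes. Fix a unit vector \<open>e\<close>, write \<open>R\<close> for the
  reflection in the hyperplane \<open>{y. y \<bullet> e = l}\<close>, and put \<open>U = u \<circ> R - u\<close> and \<open>V = v \<circ> R - v\<close> on the
  half space \<open>{y. y \<bullet> e < l}\<close>. Both functions are antisymmetric under \<open>R\<close>, so the part of the singular
  integral over the other half space can be folded back. At a nonpositive minimum \<open>x\<close> of \<open>U\<close> the
  folded integrand has a sign, and a ball of radius \<open>d = l - x \<bullet> e\<close> already contributes
  \<open>(-\<Delta>)^(\<alpha>/2) U x \<le> K * d powr - \<alpha> * U x\<close> with \<open>K > 0\<close> (\<open>negative_minimum_bound\<close>). The
  equation and the tangent line inequality for \<open>t \<mapsto> t powr p\<close>, where \<open>p \<ge> 1\<close>, bound the same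
  quantity from below by \<open>U x\<close> times the sum of the partial derivatives of the right hand side.

  For the system one minimizes \<open>min U V\<close>. At a negative minimum \<open>x\<close> of this function the two
  bounds combine to \<open>K \<le> d powr \<alpha> * c x\<close>, where \<open>c\<close> collects those partial derivatives
  (\<open>coupling_large_at_negative_minimum\<close>). This is impossible in two situations: far from the origin,
  where \<open>d\<close> is at most \<open>2 * norm x\<close> and the assumption on the exponents makes \<open>c\<close> decay
  faster than \<open>norm x powr - \<alpha>\<close>; and in a bounded region next to the plane, where \<open>d\<close> is small.
  The first fact starts the motion of the plane from \<open>l = -\<infinity>\<close>. At the last admissible
  position, if \<open>U\<close> and \<open>V\<close> were strictly positive, they would stay so on a compact set away from the
  plane for slightly larger \<open>l\<close>, and the two facts together would let the plane move on. Hence one of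
  them vanishes somewhere, and the strong maximum principle (\<open>touching_zero_strict\<close>)
  with the equations makes both vanish identically (\<open>reflection_rigid\<close>). So every direction has a
  plane of symmetry (\<open>moving_planes.symmetric_plane\<close>).

  The planes orthogonal to the coordinate axes meet in a point \<open>x0\<close>, and the composition of their
  reflections is the point reflection in \<open>x0\<close>. A symmetry plane missing \<open>x0\<close> would then
  produce a period of \<open>u\<close>, which contradicts decay and positivity. All planes therefore pass
  through \<open>x0\<close>, and any two points equidistant from \<open>x0\<close> are mirror images in one of them.

  Since the operator is defined by a limit, all of this presupposes that the limit exists. Pairing
  \<open>x + z\<close> with \<open>x - z\<close> replaces the truncated integrals by integrals of a second difference, which is
  absolutely integrable for functions with locally Lipschitz gradient (\<open>frac_laplacian_tendsto\<close>).
\<close>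

section \<open>Isometry invariance of Lebesgue measure and integrability of powers\<close>

lemma isometry_continuous_on:
  fixes f :: "'a::metric_space \<Rightarrow> 'b::metric_space"
  assumes "\<And>x y. dist (f x) (f y) = dist x y"
  shows "continuous_on S f"
  unfolding continuous_on_iff assms by blast

text \<open>This is the uniqueness argument for Haar measure. The measure of the preimage of \<open>A\<close>, multiplied by
  the volume of the unit ball, is a double integral; applying Fubini's theorem and
  the equivariance of \<open>f\<close> to it exchanges \<open>f\<close> from \<open>A\<close> to the ball, whose preimage is again
  a unit ball. It covers translations, point reflections and reflections in hyperplanes at once.\<close>

lemma lborel_distr_isometry:
  fixes f :: "'a::euclidean_space \<Rightarrow> 'a"
  assumes iso: "\<And>x y. dist (f x) (f y) = dist x y"
    and trans: "\<And>a. \<exists>b. \<forall>x. a + f x = f (b + x)"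
  shows "distr lborel borel f = lborel"
proof (rule measure_eqI)
  show "sets (distr lborel borel f) = sets lborel" by simp
next
  have "continuous_on UNIV f" by (rule isometry_continuous_on[OF iso])
  then have f[measurable]: "f \<in> borel_measurable borel"
    by (rule borel_measurable_continuous_onI)
  fix A assume "A \<in> sets (distr lborel borel f)"
  then have A[measurable]: "A \<in> sets borel" by simp
  define B where "B = ball (0::'a) 1"
  have B[measurable]: "B \<in> sets borel" unfolding B_def by simp
  have shift: "(\<integral>\<^sup>+x. g (b + x) \<partial>lborel) = (\<integral>\<^sup>+x. g x \<partial>lborel)"
    if "g \<in> borel_measurable borel" for g :: "'a \<Rightarrow> ennreal" and b
  proof -
    have "(\<integral>\<^sup>+x. g x \<partial>lborel) = (\<integral>\<^sup>+x. g x \<partial>distr lborel borel ((+) b))"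
      by (simp add: lborel_distr_plus)
    also have "\<dots> = (\<integral>\<^sup>+x. g (b + x) \<partial>lborel)"
      using that by (subst nn_integral_distr) auto
    finally show ?thesis by simp
  qed
  \<comment> \<open>The equivariance makes \<open>f\<close> surjective, so the preimage of the unit ball has a centre.\<close>
  obtain c where c: "f c = 0"
    using trans[of "- f 0"] by (metis add.right_neutral left_minus)
  have fB: "f -` B = ball c 1"
    unfolding B_def using iso[of _ c] c by (auto simp: dist_commute)
  have vol: "emeasure lborel (ball c 1) = emeasure lborel B"
    unfolding B_def by (simp add: emeasure_ball)
  have B0: "emeasure lborel B \<noteq> 0" "emeasure lborel B \<noteq> \<infinity>"
    unfolding B_def using unit_ball_vol_pos[of "real DIM('a)"] by (auto simp: emeasure_ball simp del: unit_ball_vol_pos)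
  have "emeasure (distr lborel borel f) A * emeasure lborel B
      = (\<integral>\<^sup>+x. indicator A (f x) \<partial>lborel) * emeasure lborel B"
    by (subst nn_integral_indicator[symmetric], simp, subst nn_integral_distr) auto
  also have "\<dots> = (\<integral>\<^sup>+x. indicator A (f x) * emeasure lborel B \<partial>lborel)"
    by (subst nn_integral_multc) auto
  also have "\<dots> = (\<integral>\<^sup>+x. \<integral>\<^sup>+y. indicator A (f x) * indicator B (- f x + y) \<partial>lborel \<partial>lborel)"
    by (subst nn_integral_cmult, simp, subst shift) auto
  also have "\<dots> = (\<integral>\<^sup>+y. \<integral>\<^sup>+x. indicator A (f x) * indicator B (- f x + y) \<partial>lborel \<partial>lborel)"
    by (subst lborel_pair.Fubini') auto
  also have "\<dots> = (\<integral>\<^sup>+y. \<integral>\<^sup>+x. indicator A (y + f x) * indicator B (- f x) \<partial>lborel \<partial>lborel)"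
  proof (rule nn_integral_cong)
    fix y :: 'a
    obtain b where b: "\<And>x. y + f x = f (b + x)" using trans by blast
    have "(\<integral>\<^sup>+x. indicator A (f x) * indicator B (- f x + y) \<partial>lborel)
        = (\<integral>\<^sup>+x. indicator A (f (b + x)) * indicator B (- f (b + x) + y) \<partial>lborel)"
      by (subst shift[where g = "\<lambda>x. indicator A (f x) * indicator B (- f x + y)"]) auto
    also have "\<dots> = (\<integral>\<^sup>+x. indicator A (y + f x) * indicator B (- f x) \<partial>lborel)"
      by (simp flip: b)
    finally show "(\<integral>\<^sup>+x. indicator A (f x) * indicator B (- f x + y) \<partial>lborel)
      = (\<integral>\<^sup>+x. indicator A (y + f x) * indicator B (- f x) \<partial>lborel)" .
  qed
  also have "\<dots> = (\<integral>\<^sup>+x. \<integral>\<^sup>+y. indicator A (y + f x) * indicator B (- f x) \<partial>lborel \<partial>lborel)"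
    by (subst lborel_pair.Fubini') auto
  also have "\<dots> = (\<integral>\<^sup>+x. emeasure lborel A * indicator B (- f x) \<partial>lborel)"
    by (subst nn_integral_multc, simp, subst add.commute, subst shift) auto
  also have "\<dots> = emeasure lborel A * (\<integral>\<^sup>+x. indicator B (- f x) \<partial>lborel)"
    by (subst nn_integral_cmult) auto
  also have "(\<lambda>x. indicator B (- f x)) = (indicator (f -` B) :: 'a \<Rightarrow> ennreal)"
    unfolding B_def by (auto simp: indicator_def fun_eq_iff)
  also have "integral\<^sup>N lborel (indicator (f -` B) :: 'a \<Rightarrow> ennreal) = emeasure lborel B"
    unfolding fB by (simp add: vol)
  finally show "emeasure (distr lborel borel f) A = emeasure lborel A"
    using B0 by (metis ennreal_mult_cancel_left infinity_ennreal_def mult.commute)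
qed

text \<open>On the \<open>k\<close>-th shell the integrand is comparable to \<open>(\<rho> ^ k) powr - m\<close> and the volume to
  \<open>(\<rho> ^ k) ^ DIM('a)\<close>, so the integral is dominated by a geometric series with ratio
  \<open>\<rho> powr (DIM('a) - m)\<close>. Taking \<open>\<rho> > 1\<close> treats neighbourhoods of infinity, and \<open>\<rho> < 1\<close>
  punctured neighbourhoods of the origin.\<close>

lemma powr_integrable_geometric_shells:
  fixes \<rho> m lo hi :: real and A :: "'a::euclidean_space set"
  assumes \<rho>: "0 < \<rho>" and lohi: "0 < lo" "0 < hi" and conv: "\<rho> powr (DIM('a) - m) < 1"
    and cover: "\<And>z. z \<in> A \<Longrightarrow> \<exists>k::nat. lo * \<rho> ^ k \<le> norm z \<and> norm z \<le> hi * \<rho> ^ k"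
    and A[measurable]: "A \<in> sets borel"
  shows "set_integrable lborel A (\<lambda>z. norm z powr - m)"
proof -
  define M where "M = max (lo powr - m) (hi powr - m)"
  define Q where "Q k = cball (0::'a) (hi * \<rho> ^ k)" for k :: nat
  have Q[measurable]: "Q k \<in> sets lborel" for k unfolding Q_def by simp
  define \<omega> where "\<omega> = unit_ball_vol DIM('a)"
  have \<omega>: "\<omega> \<ge> 0" unfolding \<omega>_def by simp
  have M: "M \<ge> 0" unfolding M_def by (simp add: le_max_iff_disj)
  have mono: "t powr - m \<le> M * (\<rho> ^ k) powr - m"
    if "lo * \<rho> ^ k \<le> t" "t \<le> hi * \<rho> ^ k" for t and k :: nat
  proof -
    have p: "\<rho> ^ k > 0" using \<rho> by simp
    have "lo * \<rho> ^ k > 0" using lohi p by simp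
    with that(1) have t0: "t > 0" by linarith
    have "t powr - m \<le> max ((lo * \<rho> ^ k) powr - m) ((hi * \<rho> ^ k) powr - m)"
    proof (cases "m \<ge> 0")
      case True
      then have "t powr - m \<le> (lo * \<rho> ^ k) powr - m"
        using that(1) \<rho> p lohi by (intro powr_mono2') auto
      then show ?thesis by simp
    next
      case False
      then have "t powr - m \<le> (hi * \<rho> ^ k) powr - m"
        using that(2) t0 by (intro powr_mono2) auto
      then show ?thesis by simp
    qed
    also have "\<dots> = M * (\<rho> ^ k) powr - m"
      unfolding M_def using \<rho> p lohi by (simp add: powr_mult max_mult_distrib_right)
    finally show ?thesis .
  qed
  let ?c = "\<lambda>k. M * (\<rho> ^ k) powr - m"
  have vol: "emeasure lborel (Q k) = ennreal (\<omega> * (hi * \<rho> ^ k) ^ DIM('a))" for k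
    unfolding Q_def \<omega>_def using \<rho> lohi by (subst emeasure_cball) auto
  have term_eq: "?c k * (\<omega> * (hi * \<rho> ^ k) ^ DIM('a))
     = M * \<omega> * hi ^ DIM('a) * (\<rho> powr (DIM('a) - m)) ^ k" for k
  proof -
    have "(\<rho> ^ k) powr - m * (\<rho> ^ k) ^ DIM('a) = (\<rho> powr (DIM('a) - m)) ^ k"
    proof -
      have *: "\<rho> ^ k = \<rho> powr k" using \<rho> by (simp add: powr_realpow)
      have "(\<rho> ^ k) ^ DIM('a) = \<rho> powr (real k * DIM('a))"
        using \<rho> powr_realpow[of \<rho> "k * DIM('a)"] by (simp add: power_mult)
      moreover have "(\<rho> ^ k) powr - m = \<rho> powr (real k * - m)"
        unfolding * by (rule powr_powr)
      moreover have "(\<rho> powr (DIM('a) - m)) ^ k = \<rho> powr (real k * - m + real k * DIM('a))"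
        using \<rho> powr_realpow[of "\<rho> powr (DIM('a) - m)" k]
        by (simp add: powr_powr right_diff_distrib mult.commute)
      ultimately show ?thesis by (simp only: powr_add)
    qed
    then show ?thesis by (simp only: power_mult_distrib mult.assoc mult.left_commute)
  qed
  have "(\<integral>\<^sup>+z. ennreal (indicator A z * norm z powr - m) \<partial>lborel)
     \<le> (\<integral>\<^sup>+z. (\<Sum>k. ennreal (?c k) * indicator (Q k) z) \<partial>lborel)"
  proof (rule nn_integral_mono)
    fix z :: 'a
    show "ennreal (indicator A z * norm z powr - m) \<le> (\<Sum>k. ennreal (?c k) * indicator (Q k) z)"
    proof (cases "z \<in> A")
      case True
      then obtain k :: nat where k: "lo * \<rho> ^ k \<le> norm z" "norm z \<le> hi * \<rho> ^ k"
        using cover by blast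
      then have "ennreal (indicator A z * norm z powr - m) \<le> ennreal (?c k) * indicator (Q k) z"
        using True mono[OF k] unfolding Q_def by (auto intro!: ennreal_leI)
      also have "\<dots> \<le> (\<Sum>k. ennreal (?c k) * indicator (Q k) z)"
        using sum_le_suminf[of "\<lambda>k. ennreal (?c k) * indicator (Q k) z" "{k}"]
        by (simp only: sum.insert finite.emptyI finite.insertI empty_iff sum.empty not_False_eq_True
            add_0_right summableI zero_le simp_thms)
      finally show ?thesis .
    next
      case False
      then have "ennreal (indicator A z * norm z powr - m) = 0" by simp
      then show ?thesis using zero_le by (rule ord_eq_le_trans)
    qed
  qed
  also have "\<dots> = (\<Sum>k. \<integral>\<^sup>+z. ennreal (?c k) * indicator (Q k) z \<partial>lborel)"
    by (rule nn_integral_suminf) measurable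
  also have "\<dots> = (\<Sum>k. ennreal (?c k) * emeasure lborel (Q k))"
    by (simp only: nn_integral_cmult_indicator Q)
  also have "\<dots> = (\<Sum>k. ennreal (M * \<omega> * hi ^ DIM('a) * (\<rho> powr (DIM('a) - m)) ^ k))"
  proof (rule suminf_cong)
    fix k
    have "0 \<le> ?c k" "0 \<le> \<omega> * (hi * \<rho> ^ k) ^ DIM('a)"
      using M \<omega> \<rho> lohi by (simp_all add: zero_le_mult_iff)
    then show "ennreal (?c k) * emeasure lborel (Q k)
        = ennreal (M * \<omega> * hi ^ DIM('a) * (\<rho> powr (DIM('a) - m)) ^ k)"
      by (simp only: vol term_eq[symmetric] ennreal_mult)
  qed
  also have "\<dots> < \<infinity>"
  proof -
    have "summable (\<lambda>k. M * \<omega> * hi ^ DIM('a) * (\<rho> powr (DIM('a) - m)) ^ k)"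
      using conv by (intro summable_mult summable_geometric) auto
    moreover have "0 \<le> M * \<omega> * hi ^ DIM('a) * (\<rho> powr (DIM('a) - m)) ^ k" for k
      using M \<omega> lohi by simp
    ultimately show ?thesis
      by (simp only: suminf_ennreal2 ennreal_less_top infinity_ennreal_def)
  qed
  finally have fin: "(\<integral>\<^sup>+z. ennreal (indicator A z * norm z powr - m) \<partial>lborel) < \<infinity>" .
  show ?thesis
    unfolding set_integrable_def
    by (rule integrableI_nonneg) (use fin in auto)
qed

lemma ex_dyadic_power:
  fixes t :: real
  assumes "t \<ge> 1"
  shows "\<exists>k::nat. 2 ^ k \<le> t \<and> t \<le> 2 * 2 ^ k"
proof -
  define N where "N = (LEAST n::nat. t < 2 ^ n)"
  have N: "t < 2 ^ N"
    unfolding N_def by (rule LeastI_ex) (rule real_arch_pow, simp)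
  then obtain k where k: "N = Suc k" using assms by (cases N) auto
  have "\<not> t < 2 ^ k" using not_less_Least[of k "\<lambda>n. t < 2 ^ n"] k unfolding N_def by simp
  with N k show ?thesis by (intro exI[of _ k]) auto
qed

lemma powr_integrable_outside_ball:
  fixes m \<delta> :: real
  assumes m: "m > DIM('a)" and \<delta>: "\<delta> > 0"
  shows "set_integrable lborel (- ball (0::'a::euclidean_space) \<delta>) (\<lambda>z. norm z powr - m)"
proof (rule powr_integrable_geometric_shells[where \<rho> = 2 and lo = \<delta> and hi = "2 * \<delta>"])
  show "2 powr (real DIM('a) - m) < 1"
    using m by (simp add: powr_less_one)
  fix z :: 'a assume "z \<in> - ball 0 \<delta>"
  then have "norm z / \<delta> \<ge> 1" using \<delta> by simp
  then obtain k :: nat where "2 ^ k \<le> norm z / \<delta>" "norm z / \<delta> \<le> 2 * 2 ^ k"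
    using ex_dyadic_power by blast
  then show "\<exists>k::nat. \<delta> * 2 ^ k \<le> norm z \<and> norm z \<le> 2 * \<delta> * 2 ^ k"
    using \<delta> by (intro exI[of _ k]) (simp add: pos_le_divide_eq pos_divide_le_eq mult_ac)
qed (use \<delta> in auto)

lemma powr_integrable_ball:
  fixes m :: real
  assumes m: "m < DIM('a)"
  shows "set_integrable lborel (ball (0::'a::euclidean_space) 1) (\<lambda>z. norm z powr - m)"
proof -
  have "set_integrable lborel (ball (0::'a) 1 - {0}) (\<lambda>z. norm z powr - m)"
  proof (rule powr_integrable_geometric_shells[where \<rho> = "1/2" and lo = "1/2" and hi = 1])
    show "(1/2) powr (real DIM('a) - m) < 1"
      using powr01_less_one[of "1/2" "real DIM('a) - m"] m by simp
    fix z :: 'a assume z: "z \<in> ball 0 1 - {0}"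
    then have "1 / norm z \<ge> 1" by (simp add: le_divide_eq)
    then obtain k :: nat where "2 ^ k \<le> 1 / norm z" "1 / norm z \<le> 2 * 2 ^ k"
      using ex_dyadic_power by blast
    then have "norm z * 2 ^ k \<le> 1" "1 \<le> 2 * 2 ^ k * norm z"
      using z by (simp_all add: pos_le_divide_eq pos_divide_le_eq mult_ac)
    then show "\<exists>k::nat. 1/2 * (1/2) ^ k \<le> norm z \<and> norm z \<le> 1 * (1/2) ^ k"
      using z by (intro exI[of _ k]) (simp add: power_one_over divide_le_eq le_divide_eq mult_ac)
  qed auto
  moreover have "(\<lambda>z. indicator (ball (0::'a) 1 - {0}) z *\<^sub>R norm z powr - m)
      = (\<lambda>z. indicator (ball (0::'a) 1) z *\<^sub>R norm z powr - m)"
    by (auto simp: indicator_def fun_eq_iff)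
  ultimately show ?thesis
    unfolding set_integrable_def by (simp only:)
qed

section \<open>Existence of the principal value\<close>

lemma isometry_borel_measurable:
  fixes f :: "'a::euclidean_space \<Rightarrow> 'a"
  assumes "\<And>x y. dist (f x) (f y) = dist x y"
  shows "f \<in> borel_measurable borel"
  by (intro borel_measurable_continuous_onI isometry_continuous_on assms)

lemma integral_isometry:
  fixes f :: "'a::euclidean_space \<Rightarrow> 'a" and g :: "'a \<Rightarrow> real"
  assumes iso: "\<And>x y. dist (f x) (f y) = dist x y"
    and trans: "\<And>a. \<exists>b. \<forall>x. a + f x = f (b + x)"
    and g: "g \<in> borel_measurable borel"
  shows "integral\<^sup>L lborel (\<lambda>x. g (f x)) = integral\<^sup>L lborel g"
    and "integrable lborel (\<lambda>x. g (f x)) \<longleftrightarrow> integrable lborel g"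
proof -
  have f: "f \<in> measurable lborel borel"
    using isometry_borel_measurable[OF iso] by simp
  show "integral\<^sup>L lborel (\<lambda>x. g (f x)) = integral\<^sup>L lborel g"
    using integral_distr[OF f g] lborel_distr_isometry[OF iso trans] by simp
  show "integrable lborel (\<lambda>x. g (f x)) \<longleftrightarrow> integrable lborel g"
    using integrable_distr_eq[OF f g] lborel_distr_isometry[OF iso trans] by simp
qed

text \<open>Continuity is part of the notion: it holds for all functions concerned, gives
  Borel measurability, and lets a strict inequality at one point spread to a ball.\<close>

definition weighted_L1 :: "real \<Rightarrow> ('a::euclidean_space \<Rightarrow> real) \<Rightarrow> bool" where
  "weighted_L1 k u \<longleftrightarrow> continuous_on UNIV u \<and> integrable lborel (\<lambda>x. \<bar>u x\<bar> / (1 + norm x powr k))"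

lemma weighted_L1_measurable:
  assumes "weighted_L1 k u" shows "u \<in> borel_measurable borel"
  using assms unfolding weighted_L1_def by (auto intro: borel_measurable_continuous_onI)

lemma weighted_L1_const:
  fixes c k :: real
  assumes k: "k > DIM('a)"
  shows "weighted_L1 k (\<lambda>x::'a::euclidean_space. c)"
proof -
  have "set_integrable lborel (- ball (0::'a) 1) (\<lambda>z. norm z powr - k)"
    using powr_integrable_outside_ball[OF k] by auto
  moreover have "integrable lborel (indicator (ball (0::'a) 1) :: 'a \<Rightarrow> real)"
    by (intro integrable_real_indicator) (auto simp: emeasure_ball)
  ultimately have "integrable lborel (\<lambda>z::'a. \<bar>c\<bar> * (indicator (- ball 0 1) z *\<^sub>R norm z powr - k
       + indicator (ball 0 1) z))"
    unfolding set_integrable_def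
    by (intro integrable_mult_right Bochner_Integration.integrable_add)
  then have "integrable lborel (\<lambda>x::'a. \<bar>c\<bar> / (1 + norm x powr k))"
  proof (rule Bochner_Integration.integrable_bound)
    show "(\<lambda>x::'a. \<bar>c\<bar> / (1 + norm x powr k)) \<in> borel_measurable lborel" by measurable
    have "\<bar>c\<bar> / (1 + norm x powr k)
        \<le> \<bar>c\<bar> * (indicator (- ball 0 1) x *\<^sub>R norm x powr - k + indicator (ball 0 1) x)" for x :: 'a
    proof (cases "norm x < 1")
      case True
      have "1 \<le> 1 + norm x powr k" by simp
      then have "1 / (1 + norm x powr k) \<le> 1" by (subst divide_le_eq_1_pos) linarith+
      then have "\<bar>c\<bar> * (1 / (1 + norm x powr k)) \<le> \<bar>c\<bar> * 1" by (intro mult_left_mono) auto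
      with True show ?thesis by simp
    next
      case False
      then have p: "norm x powr k > 0" by (subst powr_gt_zero) auto
      then have "1 / (1 + norm x powr k) \<le> 1 / norm x powr k"
        using p by (intro divide_left_mono mult_pos_pos add_pos_pos) linarith+
      then have "\<bar>c\<bar> * (1 / (1 + norm x powr k)) \<le> \<bar>c\<bar> * (1 / norm x powr k)"
        by (intro mult_left_mono) auto
      with False show ?thesis by (simp add: powr_minus_divide)
    qed
    then show "AE x::'a in lborel. norm (\<bar>c\<bar> / (1 + norm x powr k))
       \<le> norm (\<bar>c\<bar> * (indicator (- ball 0 1) x *\<^sub>R norm x powr - k + indicator (ball 0 1) x))"
      by (intro always_eventually allI) (simp add: abs_le_iff order_trans[OF _ abs_ge_self])
  qed
  then show ?thesis unfolding weighted_L1_def by simp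
qed

text \<open>Away from the singularity the kernel is dominated by the weight of \<open>weighted_L1\<close>, because
  \<open>norm y\<close> is at most a fixed multiple of \<open>norm (x - y)\<close> there.\<close>

lemma kernel_le_weight:
  fixes x :: "'a::euclidean_space"
  assumes \<epsilon>: "\<epsilon> > 0" and k: "k > 0"
  shows "\<exists>M\<ge>0. \<forall>y. norm (x - y) \<ge> \<epsilon> \<longrightarrow> 1 / norm (x - y) powr k \<le> M / (1 + norm y powr k)"
proof (intro exI conjI allI impI)
  let ?c = "norm x / \<epsilon> + 1"
  let ?M = "?c powr k + (1 / \<epsilon>) powr k"
  show "?M \<ge> 0" by simp
  fix y assume y: "norm (x - y) \<ge> \<epsilon>"
  define t where "t = norm (x - y)"
  have t: "t \<ge> \<epsilon>" "t > 0" using y \<epsilon> unfolding t_def by auto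
  have "norm y \<le> norm x + t" unfolding t_def by norm
  also have "norm x \<le> norm x / \<epsilon> * t"
    using mult_left_mono[OF t(1), of "norm x / \<epsilon>"] \<epsilon> by simp
  finally have "norm y \<le> ?c * t" by (simp add: algebra_simps)
  then have "norm y powr k \<le> (?c * t) powr k"
    using k by (intro powr_mono2) auto
  also have "\<dots> = ?c powr k * t powr k" using \<epsilon> t by (subst powr_mult) auto
  finally have 1: "norm y powr k \<le> ?c powr k * t powr k" .
  have "1 \<le> (1 / \<epsilon> * t) powr k" using \<epsilon> t k by (intro ge_one_powr_ge_zero) auto
  also have "\<dots> = (1 / \<epsilon>) powr k * t powr k" using \<epsilon> t by (subst powr_mult) auto
  finally have "1 + norm y powr k \<le> ?M * t powr k" using 1 by (simp add: algebra_simps)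
  moreover have "1 + norm y powr k > 0" by (intro add_pos_nonneg) auto
  ultimately show "1 / norm (x - y) powr k \<le> ?M / (1 + norm y powr k)"
    unfolding t_def[symmetric] using t by (simp add: divide_le_eq le_divide_eq)
qed

lemma weighted_L1_kernel_integrable:
  fixes u :: "'a::euclidean_space \<Rightarrow> real"
  assumes u: "weighted_L1 k u" and k: "k > 0" and \<epsilon>: "\<epsilon> > 0"
  shows "set_integrable lborel (- ball x \<epsilon>) (\<lambda>y. u y / norm (x - y) powr k)"
proof -
  note [measurable] = weighted_L1_measurable[OF u]
  obtain M where M: "M \<ge> 0"
    "\<And>y. norm (x - y) \<ge> \<epsilon> \<Longrightarrow> 1 / norm (x - y) powr k \<le> M / (1 + norm y powr k)"
    using kernel_le_weight[OF \<epsilon> k] by blast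
  have "integrable lborel (\<lambda>y. M * (\<bar>u y\<bar> / (1 + norm y powr k)))"
    using u unfolding weighted_L1_def by (intro integrable_mult_right) auto
  then show ?thesis
    unfolding set_integrable_def
  proof (rule Bochner_Integration.integrable_bound)
    show "(\<lambda>y. indicator (- ball x \<epsilon>) y *\<^sub>R (u y / norm (x - y) powr k)) \<in> borel_measurable lborel"
      by measurable
    have "\<bar>indicator (- ball x \<epsilon>) y *\<^sub>R (u y / norm (x - y) powr k)\<bar>
       \<le> \<bar>M * (\<bar>u y\<bar> / (1 + norm y powr k))\<bar>" for y
    proof (cases "norm (x - y) \<ge> \<epsilon>")
      case True
      have "\<bar>u y\<bar> * (1 / norm (x - y) powr k) \<le> \<bar>u y\<bar> * (M / (1 + norm y powr k))"
        using M(2)[OF True] by (intro mult_left_mono) auto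
      also have "\<dots> \<le> \<bar>M * (\<bar>u y\<bar> / (1 + norm y powr k))\<bar>"
        using M(1) by (simp add: abs_mult mult.commute)
      finally show ?thesis using True by (simp add: abs_mult dist_norm)
    qed (simp add: dist_norm)
    then show "AE y in lborel. norm (indicator (- ball x \<epsilon>) y *\<^sub>R (u y / norm (x - y) powr k))
       \<le> norm (M * (\<bar>u y\<bar> / (1 + norm y powr k)))"
      by simp
  qed
qed

lemma difference_kernel_integrable:
  fixes u :: "'a::euclidean_space \<Rightarrow> real"
  assumes u: "weighted_L1 k u" and k: "k > DIM('a)" and \<epsilon>: "\<epsilon> > 0"
  shows "set_integrable lborel (- ball x \<epsilon>) (\<lambda>y. (c - u y) / norm (x - y) powr k)"
proof -
  have k0: "k > 0" using k by (meson le_less_trans of_nat_0_le_iff)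
  show ?thesis
    using set_integral_diff(1)[OF weighted_L1_kernel_integrable[OF weighted_L1_const[OF k, of c] k0 \<epsilon>, of x]
      weighted_L1_kernel_integrable[OF u k0 \<epsilon>, of x]]
    by (simp add: diff_divide_distrib)
qed

definition trunc_int :: "real \<Rightarrow> ('a::euclidean_space \<Rightarrow> real) \<Rightarrow> 'a \<Rightarrow> real \<Rightarrow> real" where
  "trunc_int k u x \<epsilon> = (LINT y : - ball x \<epsilon> | lborel. (u x - u y) / norm (x - y) powr k)"

lemma trunc_int_isometry:
  fixes u :: "'a::euclidean_space \<Rightarrow> real" and f :: "'a \<Rightarrow> 'a"
  assumes iso: "\<And>x y. dist (f x) (f y) = dist x y"
    and trans: "\<And>a. \<exists>b. \<forall>x. a + f x = f (b + x)"
    and [measurable]: "u \<in> borel_measurable borel"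
  shows "trunc_int k u (f z) \<epsilon> = trunc_int k (\<lambda>y. u (f y)) z \<epsilon>"
proof -
  let ?g = "\<lambda>y. indicator (- ball (f z) \<epsilon>) y *\<^sub>R ((u (f z) - u y) / norm (f z - y) powr k)"
  have "?g \<in> borel_measurable borel" by measurable
  from integral_isometry(1)[OF iso trans this]
  show ?thesis
    unfolding trunc_int_def set_lebesgue_integral_def
    using iso by (simp add: indicator_def dist_norm)
qed

text \<open>The average of the two substitutions \<open>y = x + z\<close> and \<open>y = x - z\<close>: first order terms cancel, so that
  the integrand becomes integrable up to the singularity.\<close>

lemma trunc_int_symmetrized:
  fixes u :: "'a::euclidean_space \<Rightarrow> real"
  assumes u: "weighted_L1 k u" and k: "k > DIM('a)" and \<epsilon>: "\<epsilon> > 0"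
  shows "set_integrable lborel (- ball 0 \<epsilon>) (\<lambda>z. (2 * u x - u (x + z) - u (x - z)) / norm z powr k)"
    and "trunc_int k u x \<epsilon> =
      (LINT z : - ball 0 \<epsilon> | lborel. (2 * u x - u (x + z) - u (x - z)) / norm z powr k) / 2"
proof -
  note [measurable] = weighted_L1_measurable[OF u]
  let ?g = "\<lambda>y. indicator (- ball x \<epsilon>) y *\<^sub>R ((u x - u y) / norm (x - y) powr k)"
  have g: "?g \<in> borel_measurable borel" by measurable
  have ig: "integrable lborel ?g"
    using difference_kernel_integrable[OF u k \<epsilon>] unfolding set_integrable_def .
  have iso1: "dist (x + z) (x + w) = dist z w" for z w by simp
  have tr1: "\<exists>b. \<forall>z. a + (x + z) = x + (b + z)" for a by (intro exI[of _ a]) (simp add: algebra_simps)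
  have iso2: "dist (x - z) (x - w) = dist z w" for z w by (simp add: dist_norm norm_minus_commute)
  have tr2: "\<exists>b. \<forall>z. a + (x - z) = x - (b + z)" for a
    by (intro exI[of _ "- a"]) (simp add: algebra_simps)
  let ?g1 = "\<lambda>z. indicator (- ball 0 \<epsilon>) z *\<^sub>R ((u x - u (x + z)) / norm z powr k)"
  let ?g2 = "\<lambda>z. indicator (- ball 0 \<epsilon>) z *\<^sub>R ((u x - u (x - z)) / norm z powr k)"
  have e1: "(\<lambda>z. ?g (x + z)) = ?g1" by (auto simp: indicator_def dist_norm fun_eq_iff)
  have e2: "(\<lambda>z. ?g (x - z)) = ?g2" by (auto simp: indicator_def dist_norm fun_eq_iff)
  have i1: "integrable lborel ?g1" "integral\<^sup>L lborel ?g1 = trunc_int k u x \<epsilon>"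
    using integral_isometry[OF iso1 tr1 g] ig
    unfolding e1 trunc_int_def set_lebesgue_integral_def by auto
  have i2: "integrable lborel ?g2" "integral\<^sup>L lborel ?g2 = trunc_int k u x \<epsilon>"
    using integral_isometry[OF iso2 tr2 g] ig
    unfolding e2 trunc_int_def set_lebesgue_integral_def by auto
  have e3: "(\<lambda>z. indicator (- ball 0 \<epsilon>) z *\<^sub>R ((2 * u x - u (x + z) - u (x - z)) / norm z powr k))
     = (\<lambda>z. ?g1 z + ?g2 z)"
    by (auto simp: fun_eq_iff indicator_def add_divide_distrib diff_divide_distrib)
  show "set_integrable lborel (- ball 0 \<epsilon>) (\<lambda>z. (2 * u x - u (x + z) - u (x - z)) / norm z powr k)"
    unfolding set_integrable_def e3 using i1(1) i2(1) by (rule Bochner_Integration.integrable_add)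
  show "trunc_int k u x \<epsilon> =
      (LINT z : - ball 0 \<epsilon> | lborel. (2 * u x - u (x + z) - u (x - z)) / norm z powr k) / 2"
    unfolding set_lebesgue_integral_def e3
    using Bochner_Integration.integral_add[OF i1(1) i2(1)] i1(2) i2(2) by simp
qed

text \<open>Near the origin the integrand is at most \<open>L * norm z powr (2 - k)\<close>, which is integrable because
  \<open>k - 2\<close> is less than the dimension.\<close>

lemma second_difference_integrable:
  fixes u :: "'a::euclidean_space \<Rightarrow> real"
  assumes u: "weighted_L1 k u" and k: "k > DIM('a)" "k < DIM('a) + 2" and \<delta>: "\<delta> > 0"
    and near: "\<And>z. norm z < \<delta> \<Longrightarrow> \<bar>2 * u x - u (x + z) - u (x - z)\<bar> \<le> L * (norm z)\<^sup>2"
  shows "integrable lborel (\<lambda>z. (2 * u x - u (x + z) - u (x - z)) / norm z powr k)"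
    (is "integrable _ ?G")
proof -
  note [measurable] = weighted_L1_measurable[OF u]
  define d where "d = min \<delta> 1"
  have d: "d > 0" "d \<le> \<delta>" "d \<le> 1" unfolding d_def using \<delta> by auto
  have out: "set_integrable lborel (- ball 0 d) ?G"
    by (rule trunc_int_symmetrized(1)[OF u k(1) d(1)])
  have "set_integrable lborel (ball (0::'a) 1) (\<lambda>z. L * norm z powr - (k - 2))"
    using k by (intro set_integrable_mult_right powr_integrable_ball) auto
  then have "set_integrable lborel (ball (0::'a) d) (\<lambda>z. L * norm z powr - (k - 2))"
    by (rule set_integrable_subset) (use d in auto)
  then have "set_integrable lborel (ball 0 d) ?G"
  proof (rule set_integrable_bound)
    show "set_borel_measurable lborel (ball 0 d) ?G"
    proof -
      have "?G \<in> borel_measurable lborel" by measurable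
      then show ?thesis
        unfolding set_borel_measurable_def
        by (intro borel_measurable_scaleR borel_measurable_indicator) simp_all
    qed
    have "\<bar>?G z\<bar> \<le> \<bar>L * norm z powr - (k - 2)\<bar>" if z: "z \<in> ball 0 d" for z
    proof (cases "z = 0")
      case False
      have "\<bar>?G z\<bar> = \<bar>2 * u x - u (x + z) - u (x - z)\<bar> / norm z powr k" by simp
      also have "\<dots> \<le> L * (norm z)\<^sup>2 / norm z powr k"
        using near[of z] z d by (intro divide_right_mono) auto
      also have "\<dots> = L * norm z powr - (k - 2)"
      proof -
        have "(norm z)\<^sup>2 = norm z powr 2" using False by (simp add: powr_numeral)
        then show ?thesis using False by (simp add: powr_diff)
      qed
      finally show ?thesis by linarith
    qed simp
    then show "AE z in lborel. z \<in> ball 0 d \<longrightarrow> norm (?G z) \<le> norm (L * norm z powr - (k - 2))"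
      by (intro always_eventually) auto
  qed
  from set_integrable_Un[OF this out] show ?thesis
    by (simp add: set_integrable_def)
qed

text \<open>Dominated convergence: the truncated integrals exhaust an absolutely convergent one.\<close>

lemma trunc_int_tendsto:
  fixes u :: "'a::euclidean_space \<Rightarrow> real" and x :: 'a
  assumes u: "weighted_L1 k u" and k: "k > DIM('a)"
    and int: "integrable lborel (\<lambda>z::'a. (2 * u x - u (x + z) - u (x - z)) / norm z powr k)"
  shows "(trunc_int k u x \<longlongrightarrow> (LINT z | lborel. (2 * u x - u (x + z) - u (x - z)) / norm z powr k) / 2) (at_right 0)"
proof (rule tendsto_at_right_sequentially[where b = 1])
  fix S :: "nat \<Rightarrow> real"
  let ?G = "\<lambda>z. (2 * u x - u (x + z) - u (x - z)) / norm z powr k"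
  assume S: "\<And>n. 0 < S n" "\<And>n. S n < 1" "decseq S" "S \<longlonglongrightarrow> 0"
  have [measurable]: "?G \<in> borel_measurable borel" using int by auto
  have "(\<lambda>n. integral\<^sup>L lborel (\<lambda>z. indicator (- ball 0 (S n)) z *\<^sub>R ?G z)) \<longlonglongrightarrow> integral\<^sup>L lborel ?G"
  proof (rule integral_dominated_convergence[where w = "\<lambda>z. \<bar>?G z\<bar>"])
    show "integrable lborel (\<lambda>z. \<bar>?G z\<bar>)" using int by (rule integrable_abs)
    show "AE z in lborel. norm (indicator (- ball 0 (S n)) z *\<^sub>R ?G z) \<le> \<bar>?G z\<bar>" for n
      by (intro always_eventually allI) (simp add: indicator_def)
    have "(\<lambda>n. indicator (- ball 0 (S n)) z *\<^sub>R ?G z) \<longlonglongrightarrow> ?G z" for z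
    proof (cases "z = 0")
      case False
      then have "eventually (\<lambda>n. S n < norm z) sequentially"
        using S(4) by (intro order_tendstoD) auto
      then have "eventually (\<lambda>n. indicator (- ball 0 (S n)) z *\<^sub>R ?G z = ?G z) sequentially"
        by eventually_elim simp
      then show ?thesis by (rule tendsto_eventually)
    qed simp
    then show "AE z in lborel. (\<lambda>n. indicator (- ball 0 (S n)) z *\<^sub>R ?G z) \<longlonglongrightarrow> ?G z"
      by simp
  qed measurable
  then have "(\<lambda>n. integral\<^sup>L lborel (\<lambda>z. indicator (- ball 0 (S n)) z *\<^sub>R ?G z) / 2)
      \<longlonglongrightarrow> integral\<^sup>L lborel ?G / 2"
    by (intro tendsto_divide) auto
  then show "(\<lambda>n. trunc_int k u x (S n)) \<longlonglongrightarrow> integral\<^sup>L lborel ?G / 2"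
    by (simp only: trunc_int_symmetrized(2)[OF u k S(1)] set_lebesgue_integral_def)
qed simp

text \<open>The mean value theorem for \<open>t \<mapsto> u (x + t z) + u (x - t z)\<close> turns the second difference into a
  difference of gradients at two points that are at most \<open>2 * norm z\<close> apart.\<close>

lemma GDERIV_second_difference_bound:
  fixes u :: "'a::real_inner \<Rightarrow> real"
  assumes g: "\<And>y. GDERIV u y :> g y"
    and lip: "L-lipschitz_on (ball x \<delta>) g" and z: "norm z < \<delta>"
  shows "\<bar>2 * u x - u (x + z) - u (x - z)\<bar> \<le> 2 * L * (norm z)\<^sup>2"
proof -
  define \<phi> where "\<phi> t = u (x + t *\<^sub>R z) + u (x - t *\<^sub>R z)" for t :: real
  have der: "(\<phi> has_real_derivative (z \<bullet> g (x + t *\<^sub>R z) - z \<bullet> g (x - t *\<^sub>R z))) (at t)" for t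
  proof -
    have D: "(u has_derivative (\<lambda>h. h \<bullet> g y)) (at y)" for y
      using g unfolding gderiv_def .
    have 1: "((\<lambda>t. u (x + t *\<^sub>R z)) has_derivative (\<lambda>h. (h *\<^sub>R z) \<bullet> g (x + t *\<^sub>R z))) (at t)"
    proof (rule has_derivative_compose[OF _ D])
      show "((\<lambda>t. x + t *\<^sub>R z) has_derivative (\<lambda>h. h *\<^sub>R z)) (at t)"
        by (auto intro!: derivative_eq_intros)
    qed
    have 2: "((\<lambda>t. u (x - t *\<^sub>R z)) has_derivative (\<lambda>h. (- (h *\<^sub>R z)) \<bullet> g (x - t *\<^sub>R z))) (at t)"
    proof (rule has_derivative_compose[OF _ D])
      show "((\<lambda>t. x - t *\<^sub>R z) has_derivative (\<lambda>h. - (h *\<^sub>R z))) (at t)"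
        by (auto intro!: derivative_eq_intros)
    qed
    have "(\<phi> has_derivative (\<lambda>h. (h *\<^sub>R z) \<bullet> g (x + t *\<^sub>R z) + (- (h *\<^sub>R z)) \<bullet> g (x - t *\<^sub>R z))) (at t)"
      unfolding \<phi>_def by (rule has_derivative_add[OF 1 2])
    moreover have "(\<lambda>h. (h *\<^sub>R z) \<bullet> g (x + t *\<^sub>R z) + (- (h *\<^sub>R z)) \<bullet> g (x - t *\<^sub>R z))
        = (*) (z \<bullet> g (x + t *\<^sub>R z) - z \<bullet> g (x - t *\<^sub>R z))"
      by (simp add: fun_eq_iff algebra_simps)
    ultimately show ?thesis unfolding has_field_derivative_def by simp
  qed
  obtain t where t: "0 < t" "t < 1"
    "\<phi> 1 - \<phi> 0 = (1 - 0) * (z \<bullet> g (x + t *\<^sub>R z) - z \<bullet> g (x - t *\<^sub>R z))"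
    using MVT2[of 0 1 \<phi>, OF _ der] by auto
  have tz: "norm (t *\<^sub>R z) \<le> norm z" using t mult_right_mono[of t 1 "norm z"] by simp
  have L: "L \<ge> 0" using lip by (rule lipschitz_on_nonneg)
  have "norm (g (x + t *\<^sub>R z) - g (x - t *\<^sub>R z)) \<le> L * norm ((x + t *\<^sub>R z) - (x - t *\<^sub>R z))"
  proof -
    have "x + t *\<^sub>R z \<in> ball x \<delta>" "x - t *\<^sub>R z \<in> ball x \<delta>"
      using tz z by (auto simp: dist_norm simp del: norm_scaleR)
    from lipschitz_onD[OF lip this] show ?thesis unfolding dist_norm .
  qed
  also have "(x + t *\<^sub>R z) - (x - t *\<^sub>R z) = 2 *\<^sub>R (t *\<^sub>R z)"
    unfolding scaleR_2 by (simp only: diff_diff_eq2 add.assoc add_diff_cancel_left')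
  also have "norm (2 *\<^sub>R (t *\<^sub>R z)) = 2 * norm (t *\<^sub>R z)" by (simp only: norm_scaleR)
  also have "L * (2 * norm (t *\<^sub>R z)) \<le> L * (2 * norm z)"
    by (rule mult_left_mono[OF _ L]) (use tz in linarith)
  finally have gL: "norm (g (x + t *\<^sub>R z) - g (x - t *\<^sub>R z)) \<le> L * (2 * norm z)" .
  have "\<bar>2 * u x - u (x + z) - u (x - z)\<bar> = \<bar>\<phi> 1 - \<phi> 0\<bar>" unfolding \<phi>_def by simp
  also have "\<dots> = \<bar>z \<bullet> (g (x + t *\<^sub>R z) - g (x - t *\<^sub>R z))\<bar>" using t by (simp add: inner_diff_right)
  also have "\<dots> \<le> norm z * norm (g (x + t *\<^sub>R z) - g (x - t *\<^sub>R z))"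
    by (rule Cauchy_Schwarz_ineq2)
  also have "\<dots> \<le> norm z * (L * (2 * norm z))"
    by (rule mult_left_mono[OF gL]) simp
  finally show ?thesis
    by (simp add: power2_eq_square algebra_simps)
qed

text \<open>The bridge to the definition: \<^const>\<open>Lim\<close> carries information only once convergence is known.\<close>

lemma frac_laplacian_tendsto:
  fixes u :: "real ^ 'n \<Rightarrow> real" and \<alpha> :: real
  assumes \<alpha>: "0 < \<alpha>" "\<alpha> < 2" and u: "u \<in> L_space \<alpha> \<inter> C11_loc"
  shows "weighted_L1 (real CARD('n) + \<alpha>) u"
    and "\<exists>l. (trunc_int (real CARD('n) + \<alpha>) u x \<longlongrightarrow> l) (at_right 0) \<and> frac_laplacian C \<alpha> u x = C * l"
proof -
  obtain g where g: "\<And>x. GDERIV u x :> g x" and lip: "\<And>x. \<exists>e>0. \<exists>L. L-lipschitz_on (ball x e) g"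
    using u unfolding C11_loc_def by blast
  have cont: "continuous_on UNIV u"
    using g unfolding gderiv_def
    by (auto intro!: continuous_at_imp_continuous_on has_derivative_continuous)
  have [measurable]: "u \<in> borel_measurable borel"
    using cont by (rule borel_measurable_continuous_onI)
  show w: "weighted_L1 (real CARD('n) + \<alpha>) u"
    unfolding weighted_L1_def
    using u cont unfolding L_space_def by (simp add: integrable_completion)
  obtain e L where e: "e > 0" and L: "L-lipschitz_on (ball x e) g" using lip by blast
  have "integrable lborel (\<lambda>z. (2 * u x - u (x + z) - u (x - z)) / norm z powr (real CARD('n) + \<alpha>))"
    using \<alpha> by (intro second_difference_integrable[OF w _ _ e, of x "2 * L"]
       GDERIV_second_difference_bound[OF g L]) auto
  from trunc_int_tendsto[OF w _ this] obtain l
    where l: "(trunc_int (real CARD('n) + \<alpha>) u x \<longlongrightarrow> l) (at_right 0)" using \<alpha> by auto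
  have "(LINT y : - ball x \<epsilon> | lebesgue. (u x - u y) / norm (x - y) powr (real CARD('n) + \<alpha>))
     = trunc_int (real CARD('n) + \<alpha>) u x \<epsilon>" for \<epsilon>
    unfolding trunc_int_def set_lebesgue_integral_def by (rule integral_completion) measurable
  then have "frac_laplacian C \<alpha> u x = C * Lim (at_right 0) (trunc_int (real CARD('n) + \<alpha>) u x)"
    unfolding frac_laplacian_def by simp
  also have "Lim (at_right 0) (trunc_int (real CARD('n) + \<alpha>) u x) = l"
    by (rule tendsto_Lim[OF _ l]) simp
  finally show "\<exists>l. (trunc_int (real CARD('n) + \<alpha>) u x \<longlongrightarrow> l) (at_right 0) \<and> frac_laplacian C \<alpha> u x = C * l"
    using l by blast
qed

section \<open>Antisymmetric functions on a half space\<close>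

text \<open>Reflection in the hyperplane \<open>{y. y \<bullet> e = l}\<close> when \<open>e\<close> is a unit vector.\<close>

definition plane_refl :: "'a::euclidean_space \<Rightarrow> real \<Rightarrow> 'a \<Rightarrow> 'a" where
  "plane_refl e l y = y + (2 * (l - y \<bullet> e)) *\<^sub>R e"

lemma plane_refl_inner: "norm e = 1 \<Longrightarrow> plane_refl e l y \<bullet> e = 2 * l - y \<bullet> e"
  unfolding plane_refl_def by (simp add: inner_add_left algebra_simps norm_eq_1)

lemma plane_refl_refl [simp]: "norm e = 1 \<Longrightarrow> plane_refl e l (plane_refl e l y) = y"
  using plane_refl_inner[of e l y] unfolding plane_refl_def[of e l "plane_refl e l y"]
  by (simp add: plane_refl_def flip: scaleR_add_left)

lemma norm_diff_plane_refl:
  assumes "norm e = 1"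
  shows "(norm (x - plane_refl e l y))\<^sup>2 = (norm (x - y))\<^sup>2 + 4 * (l - x \<bullet> e) * (l - y \<bullet> e)"
proof -
  define t where "t = 2 * (l - y \<bullet> e)"
  have ee: "e \<bullet> e = 1" using assms by (simp add: norm_eq_1)
  have expand: "(norm (D - t *\<^sub>R e))\<^sup>2 = (norm D)\<^sup>2 - 2 * t * (D \<bullet> e) + t\<^sup>2" for D
    unfolding power2_norm_eq_inner inner_diff_left inner_diff_right inner_scaleR_left inner_scaleR_right
      ee inner_commute[of e D] by algebra
  have "x - plane_refl e l y = (x - y) - t *\<^sub>R e"
    unfolding plane_refl_def t_def by (simp add: algebra_simps)
  then have "(norm (x - plane_refl e l y))\<^sup>2 = (norm (x - y))\<^sup>2 - 2 * t * ((x - y) \<bullet> e) + t\<^sup>2"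
    by (simp only: expand)
  also have "\<dots> = (norm (x - y))\<^sup>2 + 4 * (l - x \<bullet> e) * (l - y \<bullet> e)"
    unfolding t_def inner_diff_left by algebra
  finally show ?thesis .
qed

lemma plane_refl_dist:
  assumes "norm e = 1"
  shows "dist (plane_refl e l x) (plane_refl e l y) = dist x y"
proof -
  have "(norm (plane_refl e l x - plane_refl e l y))\<^sup>2 = (norm (x - y))\<^sup>2"
    using norm_diff_plane_refl[OF assms, of "plane_refl e l x" l y]
      norm_diff_plane_refl[OF assms, of y l x] plane_refl_inner[OF assms, of l x]
    by (simp add: norm_minus_commute algebra_simps)
  then show ?thesis by (simp add: dist_norm power2_eq_iff_nonneg)
qed

lemma plane_refl_translate: "\<exists>b. \<forall>y. a + plane_refl e l y = plane_refl e l (b + y)" if "norm e = 1"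
  by (rule exI[of _ "a - (2 * (a \<bullet> e)) *\<^sub>R e"])
    (use that in \<open>simp add: plane_refl_def norm_eq_1 inner_add_left inner_diff_left algebra_simps\<close>)

text \<open>A point on the same side of the plane is closer than its mirror image; this inequality makes the
  kernel of the folded integral positive.\<close>

lemma norm_diff_plane_refl_gt:
  assumes "norm e = 1" "x \<bullet> e < l" "y \<bullet> e < l"
  shows "norm (x - y) < norm (x - plane_refl e l y)"
proof -
  have "4 * (l - x \<bullet> e) * (l - y \<bullet> e) > 0" using assms by (intro mult_pos_pos) auto
  then have "(norm (x - y))\<^sup>2 < (norm (x - plane_refl e l y))\<^sup>2"
    unfolding norm_diff_plane_refl[OF assms(1)] by linarith
  then show ?thesis by (rule power_less_imp_less_base) simp
qed

lemma norm_minus_plane_refl_commute: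
  assumes "norm e = 1"
  shows "norm (x - plane_refl e l y) = norm (plane_refl e l x - y)"
  using plane_refl_dist[OF assms, of l x "plane_refl e l y"] assms by (simp add: dist_norm)

text \<open>For antisymmetric \<open>w\<close> this is the integrand of the singular integral at \<open>y\<close> plus that at the mirror
  image of \<open>y\<close>, where \<open>w\<close> takes the value \<open>- w y\<close>.\<close>

definition folded_integrand :: "real \<Rightarrow> 'a::euclidean_space \<Rightarrow> real \<Rightarrow> ('a \<Rightarrow> real) \<Rightarrow> 'a \<Rightarrow> 'a \<Rightarrow> real" where
  "folded_integrand k e l w x y = (w x - w y) / norm (x - y) powr k
     + (w x + w y) / norm (x - plane_refl e l y) powr k"

text \<open>The folded integrand equals \<open>(w x - w y) * (P - Q) + 2 * w x * Q\<close>, where \<open>P > Q\<close> are the values of the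
  kernel at \<open>y\<close> and at its mirror image.\<close>

lemma folded_integrand_le:
  assumes e: "norm e = 1" and k: "k > 0" and x: "x \<bullet> e < l" and y: "y \<bullet> e < l" and xy: "x \<noteq> y" and min: "w x \<le> w y"
  shows "folded_integrand k e l w x y \<le> 2 * w x / norm (x - plane_refl e l y) powr k"
    and "w x < w y \<Longrightarrow> folded_integrand k e l w x y < 2 * w x / norm (x - plane_refl e l y) powr k"
proof -
  have lt: "norm (x - y) powr k < norm (x - plane_refl e l y) powr k"
    using norm_diff_plane_refl_gt[OF e x y] k by (intro powr_less_mono2) auto
  have pos: "norm (x - y) powr k > 0" using xy by simp
  define P Q where "P = 1 / norm (x - y) powr k" and "Q = 1 / norm (x - plane_refl e l y) powr k"
  have PQ: "Q < P" unfolding P_def Q_def using lt pos by (intro divide_strict_left_mono mult_pos_pos) linarith+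
  have eq: "folded_integrand k e l w x y = 2 * w x / norm (x - plane_refl e l y) powr k - (w y - w x) * (P - Q)"
    unfolding folded_integrand_def P_def Q_def by (simp add: algebra_simps diff_divide_distrib add_divide_distrib)
  have "(w y - w x) * (P - Q) \<ge> 0" using PQ min by simp
  then show "folded_integrand k e l w x y \<le> 2 * w x / norm (x - plane_refl e l y) powr k"
    unfolding eq by simp
  assume "w x < w y"
  then have "(w y - w x) * (P - Q) > 0" using PQ by simp
  then show "folded_integrand k e l w x y < 2 * w x / norm (x - plane_refl e l y) powr k"
    unfolding eq by simp
qed

text \<open>For small \<open>\<epsilon>\<close> the domain
  \<open>- ball x \<epsilon>\<close> splits into the half space without the ball, the mirror image of that set, the
  hyperplane, and the mirror image of the ball. The first two combine into the folded integrand, which is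
  nonpositive, so that shrinking the domain to \<open>A\<close> cannot decrease the integral. On the hyperplane the
  integrand is nonpositive because \<open>w\<close> vanishes there and \<open>w x \<le> 0\<close>, and the integral over the reflected ball tends to
  zero as the ball shrinks.\<close>

lemma antisymmetric_limit_le_folded_integral:
  fixes w :: "'a::euclidean_space \<Rightarrow> real" and k :: real
  assumes e: "norm e = 1" and k: "k > DIM('a)" and w: "weighted_L1 k w"
    and anti: "\<And>y. w (plane_refl e l y) = - w y"
    and x: "x \<bullet> e < l" and min: "\<And>y. y \<bullet> e < l \<Longrightarrow> w x \<le> w y" and neg: "w x \<le> 0"
    and lim: "(trunc_int k w x \<longlongrightarrow> L) (at_right 0)"
    and A: "A \<in> sets borel" "A \<subseteq> {y. y \<bullet> e < l}" and \<delta>: "\<delta> > 0" "A \<inter> ball x \<delta> = {}"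
  shows "set_integrable lborel A (folded_integrand k e l w x)"
    and "L \<le> (LINT y : A | lborel. folded_integrand k e l w x y)"
proof -
  note [measurable] = weighted_L1_measurable[OF w] \<open>A \<in> sets borel\<close>
  have k0: "k > 0" using k by (meson le_less_trans of_nat_0_le_iff)
  define R where "R = plane_refl e l"
  have R: "dist (R y) (R z) = dist y z" "\<exists>b. \<forall>y. a + R y = R (b + y)" "R (R y) = y"
    "R y \<bullet> e = 2 * l - y \<bullet> e" for y z a
    unfolding R_def using e plane_refl_dist plane_refl_translate plane_refl_inner by auto
  have [measurable]: "R \<in> borel_measurable borel"
    using R(1) by (rule isometry_borel_measurable)
  define h where "h y = (w x - w y) / norm (x - y) powr k" for y
  have [measurable]: "h \<in> borel_measurable borel" unfolding h_def by measurable
  have q: "folded_integrand k e l w x y = h y + h (R y)" for y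
    unfolding folded_integrand_def h_def R_def using anti by simp
  define d where "d = min (l - x \<bullet> e) \<delta>"
  have d: "d > 0" "d \<le> l - x \<bullet> e" "d \<le> \<delta>" unfolding d_def using x \<delta> by auto
  define \<Sigma> where "\<Sigma> = {y::'a. y \<bullet> e < l}"
  have [measurable]: "\<Sigma> \<in> sets borel" unfolding \<Sigma>_def by measurable
  have ball_e: "\<bar>y \<bullet> e - z \<bullet> e\<bar> \<le> dist y z" for y z
    using Cauchy_Schwarz_ineq2[of "y - z" e] e by (simp add: dist_norm inner_diff_left)
  have h_int: "set_integrable lborel B h" if "B \<in> sets borel" "B \<subseteq> - ball x \<epsilon>" "\<epsilon> > 0" for B \<epsilon>
    using set_integrable_subset[OF difference_kernel_integrable[OF w k \<open>\<epsilon> > 0\<close>, of x "w x"]] that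
    unfolding h_def by auto
  have [measurable]: "ball z \<epsilon> \<in> sets borel" for z :: 'a and \<epsilon> by simp
  have RB: "R y \<in> ball x \<epsilon> \<longleftrightarrow> y \<in> ball (R x) \<epsilon>" for y \<epsilon>
    using R(1)[of x "R y"] R(3)[of y] by simp
  have RB': "R y \<in> ball (R x) \<epsilon> \<longleftrightarrow> y \<in> ball x \<epsilon>" for y \<epsilon>
    using R(1)[of x y] by simp
  have far: "dist x y \<ge> d" if "y \<bullet> e \<ge> l" for y
    using ball_e[of y x] d that by (simp add: dist_commute)
  have near: "y \<in> \<Sigma>" if "dist x y < d" for y
    using far[of y] that unfolding \<Sigma>_def by force
  have hR_int: "set_integrable lborel (\<Sigma> - ball x \<epsilon>) (\<lambda>y. h (R y))" 
    "(LINT y : \<Sigma> - ball x \<epsilon> | lborel. h (R y)) = (LINT y : {y. y \<bullet> e > l} - ball (R x) \<epsilon> | lborel. h y)"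
    for \<epsilon>
  proof -
    let ?g = "\<lambda>y. indicator ({y. y \<bullet> e > l} - ball (R x) \<epsilon>) y *\<^sub>R h y"
    have g: "?g \<in> borel_measurable borel" by measurable
    have "integrable lborel ?g"
      using h_int[of "{y. y \<bullet> e > l} - ball (R x) \<epsilon>" d] far d
      unfolding set_integrable_def by (auto simp: subset_iff not_less)
    moreover have "(\<lambda>y. ?g (R y)) = (\<lambda>y. indicator (\<Sigma> - ball x \<epsilon>) y *\<^sub>R h (R y))"
    proof
      fix y
      have "R y \<in> {y. y \<bullet> e > l} - ball (R x) \<epsilon> \<longleftrightarrow> y \<in> \<Sigma> - ball x \<epsilon>"
        using RB'[of y \<epsilon>] R(4)[of y] unfolding \<Sigma>_def by auto
      then show "?g (R y) = indicator (\<Sigma> - ball x \<epsilon>) y *\<^sub>R h (R y)" by (simp add: indicator_def)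
    qed
    ultimately show "set_integrable lborel (\<Sigma> - ball x \<epsilon>) (\<lambda>y. h (R y))" 
      "(LINT y : \<Sigma> - ball x \<epsilon> | lborel. h (R y)) = (LINT y : {y. y \<bullet> e > l} - ball (R x) \<epsilon> | lborel. h y)"
      using integral_isometry[OF R(1,2) g] unfolding set_integrable_def set_lebesgue_integral_def by auto
  qed
  have q_int: "set_integrable lborel (\<Sigma> - ball x \<epsilon>) (folded_integrand k e l w x)" if "\<epsilon> > 0" for \<epsilon>
    unfolding q using that
    by (intro set_integral_add hR_int h_int[of _ \<epsilon>]) auto
  show qA: "set_integrable lborel A (folded_integrand k e l w x)"
    by (rule set_integrable_subset[OF q_int[OF \<delta>(1)]]) (use A \<delta> in \<open>auto simp: \<Sigma>_def\<close>)
  let ?r = "\<lambda>\<epsilon>. LINT y : ball (R x) \<epsilon> | lborel. h y"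
  have step: "trunc_int k w x \<epsilon> \<le> (LINT y : A | lborel. folded_integrand k e l w x y) + ?r \<epsilon>"
    if \<epsilon>: "0 < \<epsilon>" "\<epsilon> < d" for \<epsilon>
  proof -
    let ?P = "{y. y \<bullet> e > l} - ball (R x) \<epsilon>"
    have RBsub: "ball (R x) \<epsilon> \<subseteq> {y. y \<bullet> e > l}"
    proof
      fix y assume "y \<in> ball (R x) \<epsilon>"
      then have "dist x (R y) < d" using RB[of y \<epsilon>] \<epsilon> by simp
      from near[OF this] show "y \<in> {y. y \<bullet> e > l}" unfolding \<Sigma>_def using R(4)[of y] by simp
    qed
    have iP: "set_integrable lborel ?P h"
      by (rule h_int[of _ d]) (use far[OF less_imp_le] d in \<open>force simp: not_less\<close>)+
    have iR: "set_integrable lborel (ball (R x) \<epsilon>) h"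
      by (rule h_int[of _ d]) (use far d RBsub in \<open>auto simp: not_less subset_iff\<close>)
    have iS: "set_integrable lborel (\<Sigma> - ball x \<epsilon>) h"
      by (rule h_int[of _ \<epsilon>]) (use \<epsilon> in auto)
    have i0: "set_integrable lborel (- ball x \<epsilon>) h"
      by (rule h_int[of _ \<epsilon>]) (use \<epsilon> in auto)
    have "trunc_int k w x \<epsilon> = (LINT y : - ball x \<epsilon> | lborel. h y)"
      unfolding trunc_int_def h_def ..
    also have "\<dots> \<le> (LINT y | lborel. indicator (\<Sigma> - ball x \<epsilon>) y *\<^sub>R h y
        + indicator ?P y *\<^sub>R h y + indicator (ball (R x) \<epsilon>) y *\<^sub>R h y)"
      unfolding set_lebesgue_integral_def
    proof (rule integral_mono)
      show "integrable lborel (\<lambda>y. indicator (- ball x \<epsilon>) y *\<^sub>R h y)"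
        using i0 unfolding set_integrable_def .
      show "integrable lborel (\<lambda>y. indicator (\<Sigma> - ball x \<epsilon>) y *\<^sub>R h y
        + indicator ?P y *\<^sub>R h y + indicator (ball (R x) \<epsilon>) y *\<^sub>R h y)"
        using iP iR iS unfolding set_integrable_def by (intro Bochner_Integration.integrable_add)
      fix y :: 'a
      consider "y \<bullet> e < l" | "y \<bullet> e = l" | "y \<bullet> e > l" by linarith
      then show "indicator (- ball x \<epsilon>) y *\<^sub>R h y \<le> indicator (\<Sigma> - ball x \<epsilon>) y *\<^sub>R h y
        + indicator ?P y *\<^sub>R h y + indicator (ball (R x) \<epsilon>) y *\<^sub>R h y"
      proof cases
        case 1
        then have "y \<notin> ball (R x) \<epsilon>" "y \<notin> ?P" "y \<in> \<Sigma>" using RBsub unfolding \<Sigma>_def by auto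
        then show ?thesis by (simp add: indicator_def)
      next
        case 2
        then have "y \<notin> ball (R x) \<epsilon>" "y \<notin> ?P" "y \<notin> \<Sigma>" using RBsub unfolding \<Sigma>_def by auto
        moreover have "R y = y" using 2 unfolding R_def plane_refl_def by simp
        then have "w y = 0" using anti[of y] unfolding R_def by simp
        then have "h y \<le> 0" unfolding h_def using neg by (simp add: divide_le_0_iff)
        ultimately show ?thesis by (simp add: indicator_def)
      next
        case 3
        then have "y \<notin> \<Sigma>" "y \<notin> ball x \<epsilon>" using far[of y] \<epsilon> unfolding \<Sigma>_def by auto
        then show ?thesis using 3 by (simp add: indicator_def)
      qed
    qed
    also have "\<dots> = (LINT y : \<Sigma> - ball x \<epsilon> | lborel. h y) + (LINT y : ?P | lborel. h y) + ?r \<epsilon>"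
      using iP iR iS unfolding set_integrable_def set_lebesgue_integral_def
      by (simp only: Bochner_Integration.integral_add Bochner_Integration.integrable_add)
    also have "(LINT y : \<Sigma> - ball x \<epsilon> | lborel. h y) + (LINT y : ?P | lborel. h y)
        = (LINT y : \<Sigma> - ball x \<epsilon> | lborel. folded_integrand k e l w x y)"
      unfolding hR_int(2)[symmetric] q by (rule set_integral_add(2)[OF iS hR_int(1), symmetric])
    also have "\<dots> \<le> (LINT y : A | lborel. folded_integrand k e l w x y)"
      unfolding set_lebesgue_integral_def
    proof (rule integral_mono)
      show "integrable lborel (\<lambda>y. indicator (\<Sigma> - ball x \<epsilon>) y *\<^sub>R folded_integrand k e l w x y)"
        using q_int[OF \<epsilon>(1)] unfolding set_integrable_def .
      show "integrable lborel (\<lambda>y. indicator A y *\<^sub>R folded_integrand k e l w x y)"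
        using qA unfolding set_integrable_def .
      fix y :: 'a
      have "folded_integrand k e l w x y \<le> 0" if "y \<in> \<Sigma> - ball x \<epsilon>"
      proof -
        have "folded_integrand k e l w x y \<le> 2 * w x / norm (x - plane_refl e l y) powr k"
          using that \<epsilon> by (intro folded_integrand_le(1) e k0 x min) (auto simp: \<Sigma>_def)
        also have "\<dots> \<le> 0" using neg by (simp add: divide_le_0_iff)
        finally show ?thesis .
      qed
      moreover have "y \<in> \<Sigma> - ball x \<epsilon>" if "y \<in> A"
      proof -
        have "\<not> dist x y < \<delta>" using \<delta>(2) that by auto
        with \<epsilon> d A(2) that show ?thesis unfolding \<Sigma>_def by auto
      qed
      ultimately show "indicator (\<Sigma> - ball x \<epsilon>) y *\<^sub>R folded_integrand k e l w x y
          \<le> indicator A y *\<^sub>R folded_integrand k e l w x y"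
        by (auto simp: indicator_def)
    qed
    finally show ?thesis by simp
  qed
  \<comment> \<open>A sequence of admissible radii along which the remainder over the reflected ball disappears.\<close>
  define s where "s n = d / (real n + 2)" for n :: nat
  have s: "0 < s n" "s n < d" for n
    unfolding s_def using d by (auto simp: field_simps intro: add_pos_nonneg)
  have s0: "s \<longlonglongrightarrow> 0" unfolding s_def by real_asymp
  have "(\<lambda>n. ?r (s n)) \<longlonglongrightarrow> integral\<^sup>L lborel (\<lambda>_::'a. 0::real)"
    unfolding set_lebesgue_integral_def
  proof (rule integral_dominated_convergence[where w = "\<lambda>y. indicator (ball (R x) d) y *\<^sub>R \<bar>h y\<bar>"])
    have "set_integrable lborel (ball (R x) d) h"
    proof (rule h_int[of _ d])
      show "ball (R x) d \<subseteq> - ball x d"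
      proof
        fix y assume "y \<in> ball (R x) d"
        then have "dist x (R y) < d" using RB[of y d] by simp
        from near[OF this] have "y \<bullet> e \<ge> l" unfolding \<Sigma>_def using R(4)[of y] by simp
        from far[OF this] show "y \<in> - ball x d" by simp
      qed
    qed (use d in auto)
    from set_integrable_abs[OF this]
    show "integrable lborel (\<lambda>y. indicator (ball (R x) d) y *\<^sub>R \<bar>h y\<bar>)"
      unfolding set_integrable_def .
    show "AE y in lborel. norm (indicator (ball (R x) (s n)) y *\<^sub>R h y) \<le> indicator (ball (R x) d) y *\<^sub>R \<bar>h y\<bar>" for n
      using s[of n] by (intro always_eventually allI) (auto simp: indicator_def)
    have "AE y in lborel. y \<noteq> R x" by (rule AE_lborel_singleton)
    then show "AE y in lborel. (\<lambda>n. indicator (ball (R x) (s n)) y *\<^sub>R h y) \<longlonglongrightarrow> 0"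
    proof eventually_elim
      fix y assume "y \<noteq> R x"
      then have "eventually (\<lambda>n. s n < dist (R x) y) sequentially"
        using s0 by (intro order_tendstoD) auto
      then have "eventually (\<lambda>n. indicator (ball (R x) (s n)) y *\<^sub>R h y = 0) sequentially"
        by eventually_elim simp
      then show "(\<lambda>n. indicator (ball (R x) (s n)) y *\<^sub>R h y) \<longlonglongrightarrow> 0" by (rule tendsto_eventually)
    qed
  qed measurable
  then have r0: "(\<lambda>n. ?r (s n)) \<longlonglongrightarrow> 0" by simp
  have "filterlim s (at_right 0) sequentially"
    using s0 s by (auto simp: filterlim_at order.strict_implies_not_eq[THEN not_sym])
  then have "(\<lambda>n. trunc_int k w x (s n)) \<longlonglongrightarrow> L"
    by (rule filterlim_compose[OF lim])
  moreover have "(\<lambda>n. (LINT y : A | lborel. folded_integrand k e l w x y) + ?r (s n))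
      \<longlonglongrightarrow> (LINT y : A | lborel. folded_integrand k e l w x y) + 0"
    by (intro tendsto_add tendsto_const r0)
  ultimately show "L \<le> (LINT y : A | lborel. folded_integrand k e l w x y)"
    using LIMSEQ_le step[OF s] by fastforce
qed

lemma set_integral_ball_le:
  fixes f :: "'a::euclidean_space \<Rightarrow> real"
  assumes "set_integrable lborel (ball z r) f" and le: "\<And>y. y \<in> ball z r \<Longrightarrow> f y \<le> c" and "r \<ge> 0"
  shows "(LINT y : ball z r | lborel. f y) \<le> c * (unit_ball_vol DIM('a) * r ^ DIM('a))"
proof -
  have "(LINT y : ball z r | lborel. f y) \<le> (LINT y : ball z r | lborel. c)"
    using assms by (intro set_integral_mono) (auto simp: set_integrable_def emeasure_ball)
  also have "\<dots> = c * (unit_ball_vol DIM('a) * r ^ DIM('a))"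
    using content_ball[OF \<open>r \<ge> 0\<close>, of z]
    by (subst set_integral_const) (auto simp: emeasure_ball \<open>r \<ge> 0\<close>)
  finally show ?thesis .
qed

text \<open>Here \<open>A\<close> is the ball of radius \<open>d = l - x \<bullet> e\<close> about \<open>x - 2 d e\<close>. It lies in the half space,
  avoids \<open>ball x d\<close>, and its mirror image stays within distance \<open>5 d\<close> of \<open>x\<close>, which explains the factor
  \<open>5 powr - (DIM('a) + \<alpha>)\<close>.\<close>

lemma negative_minimum_bound:
  fixes w :: "'a::euclidean_space \<Rightarrow> real" and \<alpha> :: real
  assumes e: "norm e = 1" and \<alpha>: "\<alpha> > 0" and w: "weighted_L1 (real DIM('a) + \<alpha>) w"
    and anti: "\<And>y. w (plane_refl e l y) = - w y"
    and x: "x \<bullet> e < l" and min: "\<And>y. y \<bullet> e < l \<Longrightarrow> w x \<le> w y" and neg: "w x \<le> 0"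
    and lim: "(trunc_int (real DIM('a) + \<alpha>) w x \<longlongrightarrow> L) (at_right 0)"
  shows "L \<le> 2 * unit_ball_vol DIM('a) * 5 powr - (real DIM('a) + \<alpha>) * (l - x \<bullet> e) powr - \<alpha> * w x"
proof -
  define d where "d = l - x \<bullet> e"
  have d: "d > 0" unfolding d_def using x by simp
  define k :: real where "k = DIM('a) + \<alpha>"
  have k: "k > DIM('a)" "k > 0" unfolding k_def using \<alpha> by (auto intro: add_nonneg_pos)
  define z where "z = x - (2 * d) *\<^sub>R e"
  have ball_e: "\<bar>y \<bullet> e - z \<bullet> e\<bar> \<le> dist y z" for y
    using Cauchy_Schwarz_ineq2[of "y - z" e] e by (simp add: dist_norm inner_diff_left)
  have ze: "z \<bullet> e = x \<bullet> e - 2 * d" unfolding z_def using e by (simp add: inner_diff_left norm_eq_1)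
  have zx: "dist x z = 2 * d" unfolding z_def dist_norm using e d by simp
  have sub: "ball z d \<subseteq> {y. y \<bullet> e < l}"
  proof
    fix y assume "y \<in> ball z d"
    then have "y \<bullet> e - z \<bullet> e < d" using ball_e[of y] by (simp add: dist_commute)
    then show "y \<in> {y. y \<bullet> e < l}" using ze d unfolding d_def by simp
  qed
  have disj: "ball z d \<inter> ball x d = {}"
    using zx by (intro equals0I) (metis IntD1 IntD2 dist_commute dist_triangle_less_add less_irrefl mem_ball mult_2)
  note main = antisymmetric_limit_le_folded_integral[OF e k(1) w[folded k_def] anti x min neg
      lim[folded k_def] _ sub d disj]
  have "L \<le> (LINT y : ball z d | lborel. folded_integrand k e l w x y)"
    by (rule main(2)) auto
  also have "\<dots> \<le> (2 * w x * (5 * d) powr - k) * (unit_ball_vol DIM('a) * d ^ DIM('a))"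
  proof (rule set_integral_ball_le)
    show "set_integrable lborel (ball z d) (folded_integrand k e l w x)"
      by (rule main(1)) auto
    fix y assume y: "y \<in> ball z d"
    have ye: "y \<bullet> e < l" using y sub by auto
    have xy: "x \<noteq> y" using y zx d by (auto simp: dist_commute)
    have "folded_integrand k e l w x y \<le> 2 * w x / norm (x - plane_refl e l y) powr k"
      by (rule folded_integrand_le(1)[OF e k(2) x ye xy min[OF ye]])
    also have "\<dots> \<le> 2 * w x / (5 * d) powr k"
    proof (rule divide_left_mono_neg)
      have "norm (x - plane_refl e l y) = dist (plane_refl e l x) y"
        using norm_minus_plane_refl_commute[OF e, of x l y] by (simp add: dist_norm)
      also have "\<dots> \<le> dist (plane_refl e l x) x + dist x z + dist z y" by norm
      also have "dist (plane_refl e l x) x = 2 * d"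
        unfolding plane_refl_def dist_norm using e d by (simp add: d_def)
      finally have "norm (x - plane_refl e l y) \<le> 5 * d" using zx y by simp
      then show "norm (x - plane_refl e l y) powr k \<le> (5 * d) powr k"
        using k by (intro powr_mono2) auto
      show "2 * w x \<le> 0" using neg by simp
      have "norm (x - plane_refl e l y) > 0"
        using norm_diff_plane_refl_gt[OF e x ye] by (rule le_less_trans[OF norm_ge_zero])
      then show "0 < norm (x - plane_refl e l y) powr k * (5 * d) powr k"
        using d by simp
    qed
    also have "\<dots> = 2 * w x * (5 * d) powr - k" by (simp add: powr_minus_divide)
    finally show "folded_integrand k e l w x y \<le> 2 * w x * (5 * d) powr - k" .
  qed (use d in auto)
  also have "(5 * d) powr - k = 5 powr - k * (d powr - \<alpha> * inverse (d ^ DIM('a)))"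
  proof -
    have "(5 * d) powr - k = 5 powr - k * d powr - k" using d by (subst powr_mult) auto
    moreover have "d powr - k = d powr - \<alpha> * d powr - real DIM('a)"
      unfolding k_def powr_add[symmetric] by (simp add: algebra_simps)
    moreover have "d powr - real DIM('a) = inverse (d ^ DIM('a))"
      using d by (simp add: powr_minus powr_realpow)
    ultimately show ?thesis by (simp only:)
  qed
  also have "2 * w x * (5 powr - k * (d powr - \<alpha> * inverse (d ^ DIM('a)))) * (unit_ball_vol DIM('a) * d ^ DIM('a))
     = 2 * unit_ball_vol DIM('a) * 5 powr - k * d powr - \<alpha> * w x"
    using d by (simp add: field_simps)
  finally show ?thesis unfolding d_def k_def .
qed

text \<open>Strong maximum principle. Nonlocality makes it immediate: one point \<open>y0\<close> with \<open>w y0 > 0\<close> renders the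
  folded integrand at \<open>x\<close> strictly negative in a whole ball about \<open>y0\<close>.\<close>

lemma touching_zero_strict:
  fixes w :: "'a::euclidean_space \<Rightarrow> real" and k :: real
  assumes e: "norm e = 1" and k: "k > DIM('a)" and w: "weighted_L1 k w"
    and anti: "\<And>y. w (plane_refl e l y) = - w y"
    and x: "x \<bullet> e < l" and nonneg: "\<And>y. y \<bullet> e < l \<Longrightarrow> w y \<ge> 0" and zero: "w x = 0"
    and lim: "(trunc_int k w x \<longlongrightarrow> L) (at_right 0)"
    and y0: "y0 \<bullet> e < l" "w y0 > 0"
  shows "L < 0"
proof -
  have k0: "k > 0" using k by (meson le_less_trans of_nat_0_le_iff)
  let ?q = "folded_integrand k e l w x"
  have xy0: "x \<noteq> y0" using zero y0 by auto
  have q0: "?q y0 < 0"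
    using folded_integrand_le(2)[OF e k0 x y0(1) xy0, of w] zero y0 by simp
  have wc: "isCont w y0"
    using w unfolding weighted_L1_def by (simp add: continuous_on_eq_continuous_at)
  have "isCont ?q y0"
  proof -
    have n0: "norm (x - y0) \<noteq> 0" "norm (x - plane_refl e l y0) \<noteq> 0"
      using xy0 norm_diff_plane_refl_gt[OF e x y0(1)] by auto
    then show ?thesis
      unfolding folded_integrand_def plane_refl_def
      by (intro continuous_intros wc) (auto simp: plane_refl_def)
  qed
  then have "eventually (\<lambda>y. ?q y < ?q y0 / 2) (at y0)"
    using q0 by (intro order_tendstoD) (auto simp: isCont_def)
  then have "eventually (\<lambda>y. ?q y < ?q y0 / 2) (nhds y0)"
    using q0 by (auto simp: eventually_at_filter elim: eventually_mono)
  moreover have "eventually (\<lambda>y. y \<in> {y. y \<bullet> e < l}) (nhds y0)"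
    using y0 by (intro eventually_nhds_in_open open_halfspace_component_lt) (auto intro!: open_Collect_less continuous_intros)
  ultimately have "eventually (\<lambda>y. ?q y < ?q y0 / 2 \<and> y \<bullet> e < l) (nhds y0)"
    by eventually_elim auto
  then obtain \<rho> where \<rho>: "\<rho> > 0" "\<And>y. dist y y0 < \<rho> \<Longrightarrow> ?q y < ?q y0 / 2 \<and> y \<bullet> e < l"
    unfolding eventually_nhds_metric by blast
  define r where "r = min \<rho> (dist x y0 / 2)"
  have r: "r > 0" "r \<le> \<rho>" "2 * r \<le> dist x y0" unfolding r_def using \<rho> xy0 by auto
  have sub: "ball y0 r \<subseteq> {y. y \<bullet> e < l}" using r \<rho> by (auto simp: dist_commute)
  have disj: "ball y0 r \<inter> ball x r = {}"
    using r(3) by (intro equals0I) (metis IntD1 IntD2 dist_commute dist_triangle_less_add linorder_not_le mem_ball mult_2)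
  have min: "w x \<le> w y" if "y \<bullet> e < l" for y using nonneg[OF that] zero by simp
  have neg: "w x \<le> 0" using zero by simp
  note main = antisymmetric_limit_le_folded_integral[OF e k w anti x min neg lim _ sub r(1) disj]
  have "L \<le> (LINT y : ball y0 r | lborel. ?q y)" by (rule main(2)) auto
  also have "\<dots> \<le> ?q y0 / 2 * (unit_ball_vol DIM('a) * r ^ DIM('a))"
  proof (rule set_integral_ball_le)
    show "set_integrable lborel (ball y0 r) ?q" by (rule main(1)) auto
    fix y assume "y \<in> ball y0 r"
    then show "?q y \<le> ?q y0 / 2" using \<rho>(2)[of y] r by (auto simp: dist_commute less_imp_le)
  qed (use r in auto)
  also have "\<dots> < 0"
    using q0 r by (intro mult_neg_pos) (auto intro!: mult_pos_pos)
  finally show ?thesis .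
qed

section \<open>The fractional Laplacian of a reflected difference\<close>

text \<open>The weight changes at most by a constant factor, since \<open>norm (f y)\<close> and \<open>norm y\<close> differ by at most
  \<open>norm (f 0)\<close>.\<close>

lemma weighted_L1_isometry:
  fixes u :: "'a::euclidean_space \<Rightarrow> real" and f :: "'a \<Rightarrow> 'a"
  assumes u: "weighted_L1 k u" and k: "k > 0"
    and iso: "\<And>x y. dist (f x) (f y) = dist x y"
    and trans: "\<And>a. \<exists>b. \<forall>x. a + f x = f (b + x)"
  shows "weighted_L1 k (\<lambda>y. u (f y))"
proof -
  note [measurable] = weighted_L1_measurable[OF u] isometry_borel_measurable[OF iso]
  have cf: "continuous_on UNIV f" by (rule isometry_continuous_on[OF iso])
  have "continuous_on UNIV (\<lambda>y. u (f y))"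
    using u cf unfolding weighted_L1_def by (auto intro: continuous_on_compose2[of UNIV u])
  moreover have "integrable lborel (\<lambda>y. \<bar>u (f y)\<bar> / (1 + norm y powr k))"
  proof -
    define c where "c = norm (f 0)"
    define M where "M = 1 + 2 powr k * (1 + c powr k)"
    have M: "M \<ge> 0" unfolding M_def by (simp add: add_nonneg_nonneg)
    have bound: "1 + norm (f y) powr k \<le> M * (1 + norm y powr k)" for y
    proof -
      have "norm (f y) \<le> dist (f y) (f 0) + norm (f 0)" unfolding dist_norm by norm
      then have "norm (f y) \<le> norm y + c" unfolding iso c_def by simp
      then have "norm (f y) \<le> 2 * max (norm y) c" by simp
      then have "norm (f y) powr k \<le> (2 * max (norm y) c) powr k" using k by (intro powr_mono2) auto
      also have "\<dots> = 2 powr k * max (norm y) c powr k" unfolding c_def by (subst powr_mult) (auto simp: le_max_iff_disj)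
      also have "max (norm y) c powr k \<le> norm y powr k + c powr k" by (simp add: max_def)
      finally have "norm (f y) powr k \<le> 2 powr k * (norm y powr k + c powr k)"
        by simp
      also have "\<dots> \<le> 2 powr k * ((1 + c powr k) * (1 + norm y powr k)) "
        by (intro mult_left_mono) (auto simp: algebra_simps)
      finally have "norm (f y) powr k \<le> 2 powr k * ((1 + c powr k) * (1 + norm y powr k))" .
      moreover have "M * (1 + norm y powr k)
          = (1 + norm y powr k) + 2 powr k * ((1 + c powr k) * (1 + norm y powr k))"
        unfolding M_def by (simp add: algebra_simps)
      moreover note powr_ge_zero[of "norm y" k]
      ultimately show ?thesis by linarith
    qed
    let ?g = "\<lambda>y. \<bar>u (f y)\<bar> / (1 + norm (f y) powr k)"
    have "(\<lambda>y. \<bar>u y\<bar> / (1 + norm y powr k)) \<in> borel_measurable borel" by measurable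
    from integral_isometry(2)[OF iso trans this] have "integrable lborel ?g"
      using u unfolding weighted_L1_def by simp
    then have "integrable lborel (\<lambda>y. M * ?g y)" by (rule integrable_mult_right)
    then show ?thesis
    proof (rule Bochner_Integration.integrable_bound)
      show "(\<lambda>y. \<bar>u (f y)\<bar> / (1 + norm y powr k)) \<in> borel_measurable lborel" by measurable
      have "\<bar>u (f y)\<bar> / (1 + norm y powr k) \<le> M * ?g y" for y
      proof -
        have p: "1 + norm y powr k > 0" "1 + norm (f y) powr k > 0"
          by (auto intro: add_pos_nonneg)
        have "1 / (1 + norm y powr k) \<le> M / (1 + norm (f y) powr k)"
          using bound[of y] p by (simp add: divide_le_eq le_divide_eq)
        then have "\<bar>u (f y)\<bar> * (1 / (1 + norm y powr k)) \<le> \<bar>u (f y)\<bar> * (M / (1 + norm (f y) powr k))"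
          by (intro mult_left_mono) auto
        then show ?thesis by (simp add: mult.commute)
      qed
      moreover have "0 \<le> \<bar>u (f y)\<bar> / (1 + norm y powr k)" for y
        by (intro divide_nonneg_nonneg add_nonneg_nonneg) auto
      ultimately show "AE y in lborel. norm (\<bar>u (f y)\<bar> / (1 + norm y powr k)) \<le> norm (M * ?g y)"
        by (intro always_eventually allI) (metis abs_of_nonneg order_trans real_norm_def)
    qed
  qed
  ultimately show ?thesis unfolding weighted_L1_def by simp
qed

lemma weighted_L1_diff:
  assumes u: "weighted_L1 k u" and v: "weighted_L1 k v"
  shows "weighted_L1 k (\<lambda>x. u x - v x)"
proof -
  note [measurable] = weighted_L1_measurable[OF u] weighted_L1_measurable[OF v]
  have "integrable lborel (\<lambda>x. \<bar>u x\<bar> / (1 + norm x powr k) + \<bar>v x\<bar> / (1 + norm x powr k))"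
    using u v unfolding weighted_L1_def by (intro Bochner_Integration.integrable_add) auto
  then have "integrable lborel (\<lambda>x. \<bar>u x - v x\<bar> / (1 + norm x powr k))"
  proof (rule Bochner_Integration.integrable_bound)
    show "(\<lambda>x. \<bar>u x - v x\<bar> / (1 + norm x powr k)) \<in> borel_measurable lborel" by measurable
    have "\<bar>u x - v x\<bar> / (1 + norm x powr k) \<le> \<bar>u x\<bar> / (1 + norm x powr k) + \<bar>v x\<bar> / (1 + norm x powr k)" for x
      unfolding add_divide_distrib[symmetric]
      by (intro divide_right_mono add_nonneg_nonneg abs_triangle_ineq4) auto
    moreover have "0 \<le> \<bar>u x - v x\<bar> / (1 + norm x powr k)" for x
      by (intro divide_nonneg_nonneg add_nonneg_nonneg) auto
    ultimately show "AE x in lborel. norm (\<bar>u x - v x\<bar> / (1 + norm x powr k))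
      \<le> norm (\<bar>u x\<bar> / (1 + norm x powr k) + \<bar>v x\<bar> / (1 + norm x powr k))"
      by (intro always_eventually allI) (metis abs_of_nonneg order_trans real_norm_def)
  qed
  then show ?thesis using u v unfolding weighted_L1_def by (auto intro: continuous_on_diff)
qed

lemma trunc_int_diff:
  fixes u v :: "'a::euclidean_space \<Rightarrow> real" and k :: real
  assumes u: "weighted_L1 k u" and v: "weighted_L1 k v" and k: "k > DIM('a)" and \<epsilon>: "\<epsilon> > 0"
  shows "trunc_int k (\<lambda>x. u x - v x) x \<epsilon> = trunc_int k u x \<epsilon> - trunc_int k v x \<epsilon>"
proof -
  have "trunc_int k (\<lambda>x. u x - v x) x \<epsilon> = (LINT y : - ball x \<epsilon> | lborel.
     (u x - u y) / norm (x - y) powr k - (v x - v y) / norm (x - y) powr k)"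
    unfolding trunc_int_def by (simp add: diff_divide_distrib add_divide_distrib algebra_simps)
  also have "\<dots> = trunc_int k u x \<epsilon> - trunc_int k v x \<epsilon>"
    unfolding trunc_int_def
    by (intro set_integral_diff difference_kernel_integrable u v k \<epsilon>)
  finally show ?thesis .
qed

text \<open>Truncated integrals of \<open>u\<close> at the mirror image of \<open>x\<close> are truncated integrals of the reflected function
  at \<open>x\<close>, so the two values of the operator can be subtracted under the limit.\<close>

lemma frac_laplacian_reflected_difference:
  fixes u :: "real ^ 'n \<Rightarrow> real" and \<alpha> :: real
  assumes \<alpha>: "0 < \<alpha>" "\<alpha> < 2" and u: "u \<in> L_space \<alpha> \<inter> C11_loc" and e: "norm e = 1"
  shows "weighted_L1 (real CARD('n) + \<alpha>) (\<lambda>y. u (plane_refl e l y) - u y)"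
    and "\<exists>L. (trunc_int (real CARD('n) + \<alpha>) (\<lambda>y. u (plane_refl e l y) - u y) x \<longlongrightarrow> L) (at_right 0)
           \<and> frac_laplacian C \<alpha> u (plane_refl e l x) - frac_laplacian C \<alpha> u x = C * L"
proof -
  let ?k = "real CARD('n) + \<alpha>"
  have k: "?k > DIM(real ^ 'n)" "?k > 0" using \<alpha> by (auto intro: add_nonneg_pos)
  note w = frac_laplacian_tendsto(1)[OF \<alpha> u]
  note R = plane_refl_dist[OF e] plane_refl_translate[OF e]
  have wR: "weighted_L1 ?k (\<lambda>y. u (plane_refl e l y))"
    by (rule weighted_L1_isometry[OF w k(2) R])
  show "weighted_L1 ?k (\<lambda>y. u (plane_refl e l y) - u y)"
    by (rule weighted_L1_diff[OF wR w])
  obtain l1 where l1: "(trunc_int ?k u (plane_refl e l x) \<longlongrightarrow> l1) (at_right 0)"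
    "frac_laplacian C \<alpha> u (plane_refl e l x) = C * l1"
    using frac_laplacian_tendsto(2)[OF \<alpha> u] by blast
  obtain l2 where l2: "(trunc_int ?k u x \<longlongrightarrow> l2) (at_right 0)"
    "frac_laplacian C \<alpha> u x = C * l2"
    using frac_laplacian_tendsto(2)[OF \<alpha> u] by blast
  have "((\<lambda>\<epsilon>. trunc_int ?k u (plane_refl e l x) \<epsilon> - trunc_int ?k u x \<epsilon>) \<longlongrightarrow> l1 - l2) (at_right 0)"
    by (intro tendsto_diff l1 l2)
  moreover have "eventually (\<lambda>\<epsilon>. trunc_int ?k u (plane_refl e l x) \<epsilon> - trunc_int ?k u x \<epsilon>
     = trunc_int ?k (\<lambda>y. u (plane_refl e l y) - u y) x \<epsilon>) (at_right 0)"
    unfolding trunc_int_isometry[OF R weighted_L1_measurable[OF w]]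
    using eventually_at_right_less[of 0]
    by eventually_elim (rule trunc_int_diff[OF wR w k(1), symmetric])
  ultimately have "(trunc_int ?k (\<lambda>y. u (plane_refl e l y) - u y) x \<longlongrightarrow> l1 - l2) (at_right 0)"
    by (rule Lim_transform_eventually)
  then show "\<exists>L. (trunc_int ?k (\<lambda>y. u (plane_refl e l y) - u y) x \<longlongrightarrow> L) (at_right 0)
           \<and> frac_laplacian C \<alpha> u (plane_refl e l x) - frac_laplacian C \<alpha> u x = C * L"
    using l1(2) l2(2) by (intro exI[of _ "l1 - l2"]) (simp add: algebra_simps)
qed

text \<open>The constant of \<open>negative_minimum_bound\<close>; the type argument only transports the dimension.\<close>

definition half_space_const :: "'n::finite itself \<Rightarrow> real \<Rightarrow> real" where
  "half_space_const _ \<alpha> = 2 * unit_ball_vol CARD('n) * 5 powr - (real CARD('n) + \<alpha>)"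

lemma half_space_const_pos: "half_space_const TYPE('n::finite) \<alpha> > 0"
  unfolding half_space_const_def by simp

lemma frac_laplacian_at_negative_minimum:
  fixes u :: "real ^ 'n \<Rightarrow> real" and \<alpha> :: real
  assumes \<alpha>: "0 < \<alpha>" "\<alpha> < 2" and C: "C > 0" and u: "u \<in> L_space \<alpha> \<inter> C11_loc" and e: "norm e = 1"
    and x: "x \<bullet> e < l"
    and min: "\<And>y. y \<bullet> e < l \<Longrightarrow> u (plane_refl e l x) - u x \<le> u (plane_refl e l y) - u y"
    and neg: "u (plane_refl e l x) - u x \<le> 0"
  shows "frac_laplacian C \<alpha> u (plane_refl e l x) - frac_laplacian C \<alpha> u x
     \<le> C * half_space_const TYPE('n) \<alpha> * (l - x \<bullet> e) powr - \<alpha> * (u (plane_refl e l x) - u x)"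
proof -
  let ?w = "\<lambda>y. u (plane_refl e l y) - u y"
  obtain L where L: "(trunc_int (real CARD('n) + \<alpha>) ?w x \<longlongrightarrow> L) (at_right 0)"
    "frac_laplacian C \<alpha> u (plane_refl e l x) - frac_laplacian C \<alpha> u x = C * L"
    using frac_laplacian_reflected_difference(2)[OF \<alpha> u e] by blast
  have "L \<le> half_space_const TYPE('n) \<alpha> * (l - x \<bullet> e) powr - \<alpha> * ?w x"
    unfolding half_space_const_def
    using negative_minimum_bound[OF e \<alpha>(1), of ?w l x L]
      frac_laplacian_reflected_difference(1)[OF \<alpha> u e] x min neg L(1) e by simp
  then show ?thesis using C unfolding L(2) by (simp add: mult.assoc)
qed

lemma frac_laplacian_at_touching_zero:
  fixes u :: "real ^ 'n \<Rightarrow> real" and \<alpha> :: real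
  assumes \<alpha>: "0 < \<alpha>" "\<alpha> < 2" and C: "C > 0" and u: "u \<in> L_space \<alpha> \<inter> C11_loc" and e: "norm e = 1"
    and x: "x \<bullet> e < l" and nonneg: "\<And>y. y \<bullet> e < l \<Longrightarrow> u (plane_refl e l y) \<ge> u y"
    and zero: "u (plane_refl e l x) = u x"
    and y0: "y0 \<bullet> e < l" "u (plane_refl e l y0) \<noteq> u y0"
  shows "frac_laplacian C \<alpha> u (plane_refl e l x) - frac_laplacian C \<alpha> u x < 0"
proof -
  let ?w = "\<lambda>y. u (plane_refl e l y) - u y"
  obtain L where L: "(trunc_int (real CARD('n) + \<alpha>) ?w x \<longlongrightarrow> L) (at_right 0)"
    "frac_laplacian C \<alpha> u (plane_refl e l x) - frac_laplacian C \<alpha> u x = C * L"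
    using frac_laplacian_reflected_difference(2)[OF \<alpha> u e] by blast
  have w0: "?w y0 > 0" using nonneg[OF y0(1)] y0(2) by simp
  have "L < 0"
    by (rule touching_zero_strict[OF e _ frac_laplacian_reflected_difference(1)[OF \<alpha> u e] _ x _ _ L(1) y0(1)])
      (use nonneg zero e \<alpha> w0 in auto)
  then show ?thesis using C unfolding L(2) by (simp add: mult_pos_neg)
qed

text \<open>The convex function \<open>t \<mapsto> t powr p\<close> lies above its tangent at \<open>s\<close>.\<close>

lemma powr_diff_le_tangent:
  fixes s t p :: real
  assumes "p \<ge> 1" "0 < t" "t \<le> s"
  shows "s powr p - t powr p \<le> p * s powr (p - 1) * (s - t)"
proof (cases "t = s")
  case False
  with assms have "t < s" by simp
  have "((\<lambda>x. x powr p) has_real_derivative p * x powr (p - 1)) (at x)" if "t \<le> x" for x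
    using that assms by (auto intro!: derivative_eq_intros)
  then obtain z where z: "t < z" "z < s" "s powr p - t powr p = (s - t) * (p * z powr (p - 1))"
    using MVT2[OF \<open>t < s\<close>, of "\<lambda>x. x powr p" "\<lambda>x. p * x powr (p - 1)"] by auto
  have "z powr (p - 1) \<le> s powr (p - 1)" using z assms by (intro powr_mono2) auto
  then have "(s - t) * (p * z powr (p - 1)) \<le> (s - t) * (p * s powr (p - 1))"
    using assms by (intro mult_left_mono) auto
  then show ?thesis using z by (simp add: mult.commute)
qed simp

text \<open>The sum of the two partial derivatives of \<open>s powr p * t powr q\<close>.\<close>

definition coupling :: "real \<Rightarrow> real \<Rightarrow> real \<Rightarrow> real \<Rightarrow> real" where
  "coupling p q s t = p * s powr (p - 1) * t powr q + q * s powr p * t powr (q - 1)"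

lemma coupling_nonneg: "p \<ge> 1 \<Longrightarrow> q \<ge> 1 \<Longrightarrow> coupling p q s t \<ge> 0"
  unfolding coupling_def by simp

text \<open>Lowering both variables by at most \<open>m\<close> costs at most \<open>m\<close> times the sum of the partial derivatives
  at the upper point. An increase of the second variable only helps, hence the cut-off
  \<open>min t' t\<close> in the proof.\<close>

lemma monomial_decrease_le_coupling:
  fixes s t s' t' m p q :: real
  assumes pq: "p \<ge> 1" "q \<ge> 1" and pos: "s' > 0" "t > 0" "t' > 0"
    and s: "s - m \<le> s'" "s' \<le> s" and t: "t - m \<le> t'" and m: "m \<ge> 0"
  shows "s powr p * t powr q - s' powr p * t' powr q \<le> m * coupling p q s t"
proof -
  define t1 where "t1 = min t' t"
  have t1: "0 < t1" "t1 \<le> t" "t1 \<le> t'" "t - t1 \<le> m" unfolding t1_def using pos t m by auto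
  have "s' powr p * t1 powr q \<le> s' powr p * t' powr q"
    using t1 pq by (intro mult_left_mono powr_mono2) auto
  moreover have "(s powr p - s' powr p) * t powr q \<le> (m * (p * s powr (p - 1))) * t powr q"
  proof (intro mult_right_mono)
    have "s powr p - s' powr p \<le> p * s powr (p - 1) * (s - s')"
      using s pos pq by (intro powr_diff_le_tangent) auto
    also have "\<dots> \<le> p * s powr (p - 1) * m"
      using s pq by (intro mult_left_mono) auto
    finally show "s powr p - s' powr p \<le> m * (p * s powr (p - 1))" by (simp add: mult.commute)
  qed simp
  moreover have "s' powr p * (t powr q - t1 powr q) \<le> s powr p * (m * (q * t powr (q - 1)))"
  proof (rule mult_mono)
    show "s' powr p \<le> s powr p" using s pos pq by (intro powr_mono2) auto
    have "t powr q - t1 powr q \<le> q * t powr (q - 1) * (t - t1)"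
      using t1 pq by (intro powr_diff_le_tangent) auto
    also have "\<dots> \<le> q * t powr (q - 1) * m"
      using t1 pq by (intro mult_left_mono) auto
    finally show "t powr q - t1 powr q \<le> m * (q * t powr (q - 1))" by (simp add: mult.commute)
    have "t1 powr q \<le> t powr q" using t1 pq by (intro powr_mono2) auto
    then show "0 \<le> t powr q - t1 powr q" by simp
  qed simp
  ultimately show ?thesis unfolding coupling_def by (simp add: algebra_simps)
qed

text \<open>At a point where the differences \<open>U\<close> and \<open>V\<close> satisfy \<open>U x = min U V < 0\<close>, the decrease of the right
  hand side is at most \<open>- U x\<close> times the coupling, while the operator is at most a multiple of
  \<open>(l - x \<bullet> e) powr - \<alpha> * U x\<close>. Cancelling \<open>U x\<close> leaves a condition on the coupling alone.\<close>

lemma coupling_large_at_negative_minimum: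
  fixes u v :: "real ^ 'n \<Rightarrow> real" and \<alpha> C :: real and pp qq :: "nat \<Rightarrow> real"
  assumes \<alpha>: "0 < \<alpha>" "\<alpha> < 2" and C: "C > 0" and u: "u \<in> L_space \<alpha> \<inter> C11_loc"
    and eq: "\<And>x. frac_laplacian C \<alpha> u x = (\<Sum>i=1..N. u x powr pp i * v x powr qq i)"
    and pq: "\<And>i. i \<in> {1..N} \<Longrightarrow> pp i \<ge> 1 \<and> qq i \<ge> 1"
    and pos: "\<And>x. u x > 0" "\<And>x. v x > 0"
    and e: "norm e = 1" and x: "x \<bullet> e < l"
    and min: "\<And>y. y \<bullet> e < l \<Longrightarrow> u (plane_refl e l x) - u x \<le> u (plane_refl e l y) - u y"
    and neg: "u (plane_refl e l x) - u x < 0"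
    and v: "u (plane_refl e l x) - u x \<le> v (plane_refl e l x) - v x"
  shows "C * half_space_const TYPE('n) \<alpha> \<le> (l - x \<bullet> e) powr \<alpha> * (\<Sum>i=1..N. coupling (pp i) (qq i) (u x) (v x))"
proof -
  define m where "m = u x - u (plane_refl e l x)"
  have m: "m > 0" unfolding m_def using neg by simp
  define S where "S = (\<Sum>i=1..N. coupling (pp i) (qq i) (u x) (v x))"
  define P where "P = (l - x \<bullet> e) powr \<alpha>"
  have P: "P > 0" unfolding P_def using x by simp
  let ?K = "C * half_space_const TYPE('n) \<alpha>"
  have "frac_laplacian C \<alpha> u (plane_refl e l x) - frac_laplacian C \<alpha> u x
     \<le> ?K * (l - x \<bullet> e) powr - \<alpha> * (u (plane_refl e l x) - u x)"
    using neg by (intro frac_laplacian_at_negative_minimum[OF \<alpha> C u e x min]) auto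
  also have "\<dots> = - (?K * inverse P * m)"
    unfolding m_def P_def powr_minus by (simp add: algebra_simps)
  finally have "?K * inverse P * m \<le> (\<Sum>i=1..N. u x powr pp i * v x powr qq i
     - u (plane_refl e l x) powr pp i * v (plane_refl e l x) powr qq i)"
    unfolding eq sum_subtractf by simp
  also have "\<dots> \<le> (\<Sum>i=1..N. m * coupling (pp i) (qq i) (u x) (v x))"
    using pq pos m v neg unfolding m_def
    by (intro sum_mono monomial_decrease_le_coupling) auto
  also have "\<dots> = S * m" unfolding S_def sum_distrib_left[symmetric] by simp
  finally have "?K * inverse P \<le> S" using m by simp
  then have "?K \<le> P * S" using P by (simp add: field_simps)
  then show ?thesis unfolding P_def S_def .
qed

text \<open>If \<open>U\<close> touches zero, the equation gives a nonnegative value of the operator at that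
  point because \<open>V \<ge> 0\<close>, so the strong maximum principle forces \<open>U = 0\<close>. Inserting this into the equation for
  \<open>u\<close> makes a sum of nonnegative terms zero, whence \<open>V = 0\<close>; positivity of \<open>u\<close> and \<open>N \<ge> 1\<close> enter here.\<close>

lemma reflection_rigid:
  fixes u v :: "real ^ 'n \<Rightarrow> real" and \<alpha> C :: real and pp qq :: "nat \<Rightarrow> real"
  assumes \<alpha>: "0 < \<alpha>" "\<alpha> < 2" and C: "C > 0" and u: "u \<in> L_space \<alpha> \<inter> C11_loc"
    and N: "N \<ge> 1"
    and eq: "\<And>x. frac_laplacian C \<alpha> u x = (\<Sum>i=1..N. u x powr pp i * v x powr qq i)"
    and pq: "\<And>i. i \<in> {1..N} \<Longrightarrow> pp i \<ge> 1 \<and> qq i \<ge> 1"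
    and pos: "\<And>x. u x > 0" "\<And>x. v x > 0"
    and e: "norm e = 1" and x: "x \<bullet> e < l"
    and nonneg: "\<And>y. y \<bullet> e < l \<Longrightarrow> u (plane_refl e l y) \<ge> u y"
      "\<And>y. y \<bullet> e < l \<Longrightarrow> v (plane_refl e l y) \<ge> v y"
    and zero: "u (plane_refl e l x) = u x" and y: "y \<bullet> e < l"
  shows "u (plane_refl e l y) = u y" and "v (plane_refl e l y) = v y"
proof -
  have mono: "v y powr qq i \<le> v (plane_refl e l y) powr qq i" if "y \<bullet> e < l" "i \<in> {1..N}" for y i
    using nonneg(2)[OF that(1)] pq[OF that(2)] less_imp_le[OF pos(2)] by (intro powr_mono2) auto
  have u_eq: "u (plane_refl e l y) = u y" if y: "y \<bullet> e < l" for y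
  proof (rule ccontr)
    assume ne: "u (plane_refl e l y) \<noteq> u y"
    have "frac_laplacian C \<alpha> u (plane_refl e l x) - frac_laplacian C \<alpha> u x < 0"
      by (rule frac_laplacian_at_touching_zero[OF \<alpha> C u e x nonneg(1) zero y ne])
    moreover have "frac_laplacian C \<alpha> u x \<le> frac_laplacian C \<alpha> u (plane_refl e l x)"
      unfolding eq zero using mono[OF x] by (intro sum_mono mult_left_mono) auto
    ultimately show False by simp
  qed
  show "u (plane_refl e l y) = u y" by (rule u_eq[OF y])
  let ?w = "\<lambda>y. u (plane_refl e l y) - u y"
  \<comment> \<open>The operator sees all of space, so the vanishing has to be extended across the plane.\<close>
  have w0: "?w z = 0" for z
  proof -
    consider "z \<bullet> e < l" | "z \<bullet> e = l" | "plane_refl e l z \<bullet> e < l"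
      using plane_refl_inner[OF e, of l z] by linarith
    then show ?thesis
    proof cases
      case 1 then show ?thesis using u_eq by simp
    next
      case 2 then show ?thesis by (simp add: plane_refl_def)
    next
      case 3 then show ?thesis using u_eq[of "plane_refl e l z"] e by simp
    qed
  qed
  have "frac_laplacian C \<alpha> u (plane_refl e l y) - frac_laplacian C \<alpha> u y = 0"
  proof -
    obtain L where L: "(trunc_int (real CARD('n) + \<alpha>) ?w y \<longlongrightarrow> L) (at_right 0)"
      "frac_laplacian C \<alpha> u (plane_refl e l y) - frac_laplacian C \<alpha> u y = C * L"
      using frac_laplacian_reflected_difference(2)[OF \<alpha> u e] by blast
    have "trunc_int (real CARD('n) + \<alpha>) ?w y = (\<lambda>\<epsilon>. 0)"
      unfolding trunc_int_def w0 by simp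
    with L(1) have "L = 0" using tendsto_unique[OF _ L(1), of 0] by simp
    then show ?thesis using L(2) by simp
  qed
  then have s0: "(\<Sum>i=1..N. u y powr pp i * (v (plane_refl e l y) powr qq i - v y powr qq i)) = 0"
    unfolding eq u_eq[OF y] by (simp add: sum_subtractf right_diff_distrib)
  have "u y powr pp i * (v (plane_refl e l y) powr qq i - v y powr qq i) = 0" if "i \<in> {1..N}" for i
    using that s0 mono[OF y] by (subst (asm) sum_nonneg_eq_0_iff) auto
  from this[of 1] N have "v (plane_refl e l y) powr qq 1 = v y powr qq 1"
    using pos(1)[of y] by simp
  moreover have "v y powr qq 1 < v (plane_refl e l y) powr qq 1" if "v y < v (plane_refl e l y)"
    using that pq[of 1] N pos(2)[of y] by (intro powr_less_mono2) auto
  ultimately show "v (plane_refl e l y) = v y"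
    using nonneg(2)[OF y] by fastforce
qed

section \<open>Moving planes\<close>

text \<open>What the sweep of the planes needs to know about the system. The function \<open>c\<close> bounds the linearized
  right hand sides of both equations; the assumption \<open>minimum\<close> is the combined effect of the equations at a negative
  minimum of the smaller difference, and \<open>rigid\<close> is the strong maximum principle. Stated in terms of the
  minimum of the two differences, the argument is the same as for a single equation.\<close>

locale moving_planes =
  fixes u v c :: "'a::euclidean_space \<Rightarrow> real" and \<alpha> \<kappa> :: real
  assumes cont: "continuous_on UNIV u" "continuous_on UNIV v" "continuous_on UNIV c"
    and pos: "\<And>x. u x > 0" "\<And>x. v x > 0" and c_nonneg: "\<And>x. c x \<ge> 0" and \<alpha>: "\<alpha> > 0" and \<kappa>: "\<kappa> > 0"
    and vanish: "\<And>\<epsilon>. \<epsilon> > 0 \<Longrightarrow> \<exists>R. \<forall>x. norm x > R \<longrightarrow> u x < \<epsilon> \<and> v x < \<epsilon>"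
    and c_decay: "\<exists>R. \<forall>x. norm x > R \<longrightarrow> (2 * norm x) powr \<alpha> * c x < \<kappa>"
    and minimum: "\<And>e l x. norm e = 1 \<Longrightarrow> x \<bullet> e < l
      \<Longrightarrow> min (u (plane_refl e l x) - u x) (v (plane_refl e l x) - v x) < 0
      \<Longrightarrow> (\<And>y. y \<bullet> e < l \<Longrightarrow> min (u (plane_refl e l x) - u x) (v (plane_refl e l x) - v x)
                 \<le> min (u (plane_refl e l y) - u y) (v (plane_refl e l y) - v y))
      \<Longrightarrow> \<kappa> \<le> (l - x \<bullet> e) powr \<alpha> * c x"
    and rigid: "\<And>e l x y. norm e = 1 \<Longrightarrow> x \<bullet> e < l
      \<Longrightarrow> (\<And>y. y \<bullet> e < l \<Longrightarrow> u (plane_refl e l y) \<ge> u y \<and> v (plane_refl e l y) \<ge> v y)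
      \<Longrightarrow> u (plane_refl e l x) = u x \<or> v (plane_refl e l x) = v x
      \<Longrightarrow> y \<bullet> e < l \<Longrightarrow> u (plane_refl e l y) = u y \<and> v (plane_refl e l y) = v y"
begin

definition gap :: "'a \<Rightarrow> real \<Rightarrow> 'a \<Rightarrow> real" where
  "gap e l x = min (u (plane_refl e l x) - u x) (v (plane_refl e l x) - v x)"

lemma continuous_on_gap:
  assumes "continuous_on S f" "continuous_on S g"
  shows "continuous_on S (\<lambda>t. gap e (f t) (g t))"
proof -
  have R: "continuous_on S (\<lambda>t. plane_refl e (f t) (g t))"
    unfolding plane_refl_def by (intro continuous_intros assms)
  show ?thesis
    unfolding gap_def
    by (intro continuous_on_min continuous_on_diff
        continuous_on_compose2[OF cont(1) R] continuous_on_compose2[OF cont(1) assms(2)]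
        continuous_on_compose2[OF cont(2) R] continuous_on_compose2[OF cont(2) assms(2)]) auto
qed

text \<open>Where \<open>u\<close> and \<open>v\<close> are below a given \<open>\<epsilon>\<close>, the differences exceed \<open>- \<epsilon>\<close> by positivity, so a negative
  infimum is attained on a compact set; it is not attained on the plane, where the gap is zero.\<close>

lemma gap_minimum_attained:
  assumes e: "norm e = 1" and x1: "x1 \<bullet> e < l" "gap e l x1 < 0"
  shows "\<exists>x. x \<bullet> e < l \<and> gap e l x < 0 \<and> (\<forall>y. y \<bullet> e < l \<longrightarrow> gap e l x \<le> gap e l y)"
proof -
  obtain R where R: "\<And>x. norm x > R \<Longrightarrow> u x < - gap e l x1 \<and> v x < - gap e l x1"
    using vanish[of "- gap e l x1"] x1(2) by auto
  have far: "gap e l x1 < gap e l y" if "norm y > R" for y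
    using R[OF that] pos(1)[of "plane_refl e l y"] pos(2)[of "plane_refl e l y"]
    unfolding gap_def[of e l y] by linarith
  define K where "K = {y. y \<bullet> e \<le> l} \<inter> cball 0 (max R (norm x1))"
  have "compact K"
    unfolding K_def
    by (intro closed_Int_compact compact_cball closed_Collect_le continuous_intros)
  moreover have "x1 \<in> K" unfolding K_def using x1 by simp
  moreover have "continuous_on K (gap e l)"
    using continuous_on_gap[OF continuous_on_const continuous_on_id] .
  ultimately obtain x where x: "x \<in> K" "\<And>y. y \<in> K \<Longrightarrow> gap e l x \<le> gap e l y"
    using continuous_attains_inf[of K "gap e l"] by blast
  have le: "gap e l x \<le> gap e l x1" using x \<open>x1 \<in> K\<close> by blast
  have "x \<bullet> e \<noteq> l"
  proof
    assume "x \<bullet> e = l"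
    then have "gap e l x = 0" unfolding gap_def plane_refl_def by simp
    then show False using le x1 by simp
  qed
  then have "x \<bullet> e < l" using x(1) unfolding K_def by auto
  moreover have "gap e l x \<le> gap e l y" if y: "y \<bullet> e < l" for y
  proof (cases "norm y > R")
    case True
    then show ?thesis using far[OF True] le by simp
  next
    case False
    then have "y \<in> K" unfolding K_def using y by auto
    then show ?thesis by (rule x(2))
  qed
  moreover have "gap e l x < 0" using le x1 by linarith
  ultimately show ?thesis by blast
qed

lemma gap_nonneg_criterion:
  assumes e: "norm e = 1" and x: "x \<bullet> e < l"
    and small: "\<And>y. y \<bullet> e < l \<Longrightarrow> gap e l y < 0 \<Longrightarrow> (l - y \<bullet> e) powr \<alpha> * c y < \<kappa>"
  shows "gap e l x \<ge> 0"
proof (rule ccontr)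
  assume "\<not> gap e l x \<ge> 0"
  then obtain y where y: "y \<bullet> e < l" "gap e l y < 0" "\<And>z. z \<bullet> e < l \<Longrightarrow> gap e l y \<le> gap e l z"
    using gap_minimum_attained[OF e x] by auto
  have "\<kappa> \<le> (l - y \<bullet> e) powr \<alpha> * c y"
    using minimum[OF e y(1)] y(2,3) unfolding gap_def by blast
  with small[OF y(1,2)] show False by simp
qed

text \<open>The critical position is the infimum \<open>\<Lambda>\<close> of all positions at which the gap is negative somewhere.
  The three steps are that this infimum is finite, that the gap is nonnegative at \<open>\<Lambda>\<close> by continuity, and
  that a strictly positive gap at \<open>\<Lambda>\<close> could be pushed beyond it.\<close>

lemma symmetric_plane:
  assumes e: "norm e = 1"
  shows "\<exists>l. \<forall>x. u (plane_refl e l x) = u x \<and> v (plane_refl e l x) = v x"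
proof -
  define bad where "bad = {l. \<exists>x. x \<bullet> e < l \<and> gap e l x < 0}"
  obtain R1 where R1: "\<And>x. norm x > R1 \<Longrightarrow> (2 * norm x) powr \<alpha> * c x < \<kappa>"
    using c_decay by blast
  have xe: "\<bar>x \<bullet> e\<bar> \<le> norm x" for x using Cauchy_Schwarz_ineq2[of x e] e by simp
  have far: "(l - x \<bullet> e) powr \<alpha> * c x < \<kappa>"
    if "norm x > R1" "l \<le> norm x" "x \<bullet> e < l" for x l
  proof -
    have "(l - x \<bullet> e) powr \<alpha> \<le> (2 * norm x) powr \<alpha>"
      using that xe[of x] \<alpha> by (intro powr_mono2) auto
    then have "(l - x \<bullet> e) powr \<alpha> * c x \<le> (2 * norm x) powr \<alpha> * c x"
      using c_nonneg by (intro mult_right_mono) auto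
    with R1[OF that(1)] show ?thesis by simp
  qed
  have lower: "- max R1 0 \<le> l" if "l \<in> bad" for l
  proof (rule ccontr)
    assume l: "\<not> - max R1 0 \<le> l"
    obtain x where x: "x \<bullet> e < l" "gap e l x < 0" using \<open>l \<in> bad\<close> unfolding bad_def by blast
    have "gap e l x \<ge> 0"
    proof (rule gap_nonneg_criterion[OF e x(1)])
      fix y assume y: "y \<bullet> e < l"
      then have "norm y > R1" "norm y \<ge> l" using l xe[of y] by auto
      then show "(l - y \<bullet> e) powr \<alpha> * c y < \<kappa>" using y by (intro far)
    qed
    with x show False by simp
  qed
  then have bdd: "bdd_below bad" by (meson bdd_belowI)
  have ne: "bad \<noteq> {}"
  proof -
    obtain R where R: "\<And>x. norm x > R \<Longrightarrow> u x < u 0 \<and> v x < u 0" using vanish[OF pos(1)[of 0]] by blast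
    define l where "l = \<bar>R\<bar> + 1"
    have "norm (plane_refl e l 0) > R" unfolding plane_refl_def l_def using e by simp
    from R[OF this] have "gap e l 0 < 0" unfolding gap_def min_less_iff_disj by linarith
    moreover have "0 \<bullet> e < l" unfolding l_def by simp
    ultimately show ?thesis unfolding bad_def by blast
  qed
  define \<Lambda> where "\<Lambda> = Inf bad"
  have below: "gap e l x \<ge> 0" if "l < \<Lambda>" "x \<bullet> e < l" for l x
    using that cInf_lower[OF _ bdd, of l] unfolding \<Lambda>_def bad_def by force
  have at: "gap e \<Lambda> x \<ge> 0" if x: "x \<bullet> e < \<Lambda>" for x
  proof -
    have "continuous_on UNIV (\<lambda>l. gap e l x)"
      by (intro continuous_on_gap continuous_intros)
    then have "((\<lambda>l. gap e l x) \<longlongrightarrow> gap e \<Lambda> x) (at_left \<Lambda>)"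
      by (simp add: continuous_on_def tendsto_within_subset[of _ _ _ UNIV])
    moreover have "eventually (\<lambda>l. gap e l x \<ge> 0) (at_left \<Lambda>)"
      using eventually_at_left_real[OF x] by eventually_elim (auto intro: below)
    ultimately show ?thesis by (rule tendsto_lowerbound) simp
  qed
  have nonneg: "u (plane_refl e \<Lambda> y) \<ge> u y \<and> v (plane_refl e \<Lambda> y) \<ge> v y" if "y \<bullet> e < \<Lambda>" for y
    using at[OF that] unfolding gap_def by simp
  have "\<exists>x. x \<bullet> e < \<Lambda> \<and> gap e \<Lambda> x \<le> 0"
  proof (rule ccontr)
    assume "\<nexists>x. x \<bullet> e < \<Lambda> \<and> gap e \<Lambda> x \<le> 0"
    then have strict: "gap e \<Lambda> x > 0" if "x \<bullet> e < \<Lambda>" for x using that by force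
    \<comment> \<open>Beyond radius \<open>R2\<close> every position \<open>l < \<Lambda> + 1\<close> is covered by the decay of \<open>c\<close>.\<close>
    define R2 where "R2 = max R1 (\<bar>\<Lambda>\<bar> + 1)"
    have "bounded (c ` cball 0 R2)"
      using cont(3) by (intro compact_imp_bounded compact_continuous_image compact_cball)
        (auto intro: continuous_on_subset)
    then obtain M where M: "M > 0" "\<And>x. norm x \<le> R2 \<Longrightarrow> c x \<le> M"
      unfolding bounded_pos by (force simp: abs_le_iff)
    \<comment> \<open>Inside radius \<open>R2\<close>, points within \<open>2 * \<delta>\<close> of the plane cannot be negative minima.\<close>
    obtain \<delta> where \<delta>: "\<delta> > 0" "\<delta> < 1" "(2 * \<delta>) powr \<alpha> * M < \<kappa>"
    proof -
      have "((\<lambda>t. (2 * t) powr \<alpha> * M) \<longlongrightarrow> (2 * 0) powr \<alpha> * M) (at_right 0)"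
        using \<alpha> by (intro tendsto_intros) (auto simp: eventually_at_filter)
      then have "eventually (\<lambda>t. (2 * t) powr \<alpha> * M < \<kappa>) (at_right 0)"
        using \<kappa> by (intro order_tendstoD(2)) auto
      moreover have "eventually (\<lambda>t::real. t \<in> {0<..<1}) (at_right 0)"
        by (rule eventually_at_right_real) simp
      ultimately have "eventually (\<lambda>t. (2 * t) powr \<alpha> * M < \<kappa> \<and> t \<in> {0<..<1}) (at_right 0)"
        by (rule eventually_conj)
      then obtain t where "(2 * t) powr \<alpha> * M < \<kappa> \<and> t \<in> {0<..<1}"
        using eventually_happens by force
      then show ?thesis using that by auto
    qed
    define K where "K = {y. y \<bullet> e \<le> \<Lambda> - \<delta>} \<inter> cball 0 R2"
    have K: "compact K"
      unfolding K_def
      by (intro closed_Int_compact compact_cball closed_Collect_le continuous_intros)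
    \<comment> \<open>The positions at which the gap is nonpositive somewhere on \<open>K\<close> form a closed set missing \<open>\<Lambda>\<close>,
      because \<open>K\<close> is compact.\<close>
    define P where "P = fst ` (({\<Lambda>..\<Lambda> + 1} \<times> K) \<inter> {p. gap e (fst p) (snd p) \<le> 0})"
    have "compact P"
      unfolding P_def
      by (intro compact_continuous_image compact_Int_closed compact_Times compact_Icc K
          closed_Collect_le continuous_on_gap continuous_intros)
    then have "open (- P)" by (simp add: compact_imp_closed open_Compl)
    moreover have "\<Lambda> \<in> - P"
    proof (rule ComplI)
      assume "\<Lambda> \<in> P"
      then obtain y where "y \<in> K" "gap e \<Lambda> y \<le> 0" unfolding P_def by auto
      then show False using strict[of y] \<delta> unfolding K_def by simp
    qed
    ultimately obtain \<eta> where \<eta>: "\<eta> > 0" "\<And>l. dist l \<Lambda> < \<eta> \<Longrightarrow> l \<in> - P"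
      by (metis open_dist)
    define \<delta>' where "\<delta>' = min \<delta> \<eta>"
    have \<delta>': "\<delta>' > 0" "\<delta>' \<le> \<delta>" "\<delta>' \<le> \<eta>" unfolding \<delta>'_def using \<delta> \<eta> by auto
    have good: "gap e l x \<ge> 0" if l: "\<Lambda> \<le> l" "l < \<Lambda> + \<delta>'" and x: "x \<bullet> e < l" for l x
    proof (rule gap_nonneg_criterion[OF e x])
      fix y assume y: "y \<bullet> e < l" "gap e l y < 0"
      show "(l - y \<bullet> e) powr \<alpha> * c y < \<kappa>"
      proof (cases "norm y > R2")
        case True
        then show ?thesis using y l \<delta> \<delta>' by (intro far) (auto simp: R2_def)
      next
        case False
        have "l \<notin> P" using \<eta>(2)[of l] l \<delta>' by (auto simp: dist_real_def)
        have "y \<notin> K"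
        proof
          assume "y \<in> K"
          then have "(l, y) \<in> ({\<Lambda>..\<Lambda> + 1} \<times> K) \<inter> {p. gap e (fst p) (snd p) \<le> 0}"
            using l \<delta> \<delta>' y by auto
          then have "l \<in> P" unfolding P_def by force
          with \<open>l \<notin> P\<close> show False by simp
        qed
        then have "y \<bullet> e > \<Lambda> - \<delta>" using False unfolding K_def by auto
        then have "(l - y \<bullet> e) powr \<alpha> \<le> (2 * \<delta>) powr \<alpha>"
          using l y \<delta>' \<alpha> by (intro powr_mono2) auto
        then have "(l - y \<bullet> e) powr \<alpha> * c y \<le> (2 * \<delta>) powr \<alpha> * M"
          using M(2)[of y] False c_nonneg by (intro mult_mono) auto
        with \<delta>(3) show ?thesis by simp
      qed
    qed
    have "\<Lambda> + \<delta>' \<le> Inf bad"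
    proof (rule cInf_greatest[OF ne])
      fix l assume "l \<in> bad"
      then obtain x where x: "x \<bullet> e < l" "gap e l x < 0" unfolding bad_def by blast
      with good[of l x] below[of l x] show "\<Lambda> + \<delta>' \<le> l" by force
    qed
    then show False unfolding \<Lambda>_def using \<delta>'(1) by simp
  qed
  then obtain x where x: "x \<bullet> e < \<Lambda>" "gap e \<Lambda> x \<le> 0" by blast
  have "u (plane_refl e \<Lambda> x) = u x \<or> v (plane_refl e \<Lambda> x) = v x"
    using x(2) nonneg[OF x(1)] unfolding gap_def by linarith
  then have half: "u (plane_refl e \<Lambda> y) = u y \<and> v (plane_refl e \<Lambda> y) = v y" if "y \<bullet> e < \<Lambda>" for y
    using rigid[OF e x(1) nonneg _ that] by blast
  show ?thesis
  proof (intro exI allI)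
    fix z
    consider "z \<bullet> e < \<Lambda>" | "z \<bullet> e = \<Lambda>" | "plane_refl e \<Lambda> z \<bullet> e < \<Lambda>"
      using plane_refl_inner[OF e, of \<Lambda> z] by linarith
    then show "u (plane_refl e \<Lambda> z) = u z \<and> v (plane_refl e \<Lambda> z) = v z"
    proof cases
      case 1 then show ?thesis by (rule half)
    next
      case 2 then show ?thesis by (simp add: plane_refl_def)
    next
      case 3 then show ?thesis using half[of "plane_refl e \<Lambda> z"] e by simp
    qed
  qed
qed

text \<open>A period would carry the positive value \<open>u 0\<close> to infinity.\<close>

lemma no_translation_invariance:
  assumes "t \<noteq> 0"
  shows "\<exists>x. u (x + t) \<noteq> u x"
proof (rule ccontr)
  assume "\<nexists>x. u (x + t) \<noteq> u x"
  then have inv: "u (x + t) = u x" for x by blast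
  have mult: "u (real n *\<^sub>R t) = u 0" for n
  proof (induction n)
    case (Suc n)
    then show ?case using inv[of "real n *\<^sub>R t"] by (simp add: scaleR_add_left add.commute)
  qed simp
  obtain R where R: "\<And>x. norm x > R \<Longrightarrow> u x < u 0" using vanish[OF pos(1)[of 0]] by blast
  obtain n :: nat where "R / norm t < real n" using reals_Archimedean2 by blast
  then have "norm (real n *\<^sub>R t) > R" using assms by (simp add: divide_less_eq)
  from R[OF this] mult show False by simp
qed

end

text \<open>The point \<open>x0\<close> is the intersection of the symmetry planes orthogonal to the basis vectors. If the
  symmetry plane in direction \<open>e\<close> has height \<open>L e\<close>, then reflecting in it, in \<open>x0\<close>, in the plane and in \<open>x0\<close>
  again is the translation by \<open>4 * (L e - x0 \<bullet> e)\<close> along \<open>e\<close>, so the plane contains \<open>x0\<close>.\<close>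

lemma radial_from_symmetric_planes:
  fixes \<phi> :: "'a::euclidean_space \<Rightarrow> 'b"
  assumes planes: "\<And>e. norm e = 1 \<Longrightarrow> \<exists>l. \<forall>x. \<phi> (plane_refl e l x) = \<phi> x"
    and no_trans: "\<And>t. t \<noteq> 0 \<Longrightarrow> \<exists>x. \<phi> (x + t) \<noteq> \<phi> x"
  shows "\<exists>x0. \<forall>x y. norm (x - x0) = norm (y - x0) \<longrightarrow> \<phi> x = \<phi> y"
proof -
  obtain L where L: "\<And>e x. norm e = 1 \<Longrightarrow> \<phi> (plane_refl e (L e) x) = \<phi> x"
    using planes by metis
  define x0 where "x0 = (\<Sum>b\<in>Basis. L b *\<^sub>R b)"
  have partial: "\<phi> (x + (\<Sum>b\<in>B. (2 * (L b - x \<bullet> b)) *\<^sub>R b)) = \<phi> x" if "B \<subseteq> Basis" for B x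
    using finite_subset[OF that finite_Basis] that
  proof (induction B rule: finite_induct)
    case (insert b B)
    define x' where "x' = x + (\<Sum>b\<in>B. (2 * (L b - x \<bullet> b)) *\<^sub>R b)"
    have b: "b \<in> Basis" "B \<subseteq> Basis" using insert by auto
    have "(\<Sum>i\<in>B. (2 * (L i - x \<bullet> i)) *\<^sub>R i) \<bullet> b = 0"
      unfolding inner_sum_left
      using insert.hyps(2) b by (intro sum.neutral) (auto intro!: inner_not_same_Basis)
    then have "x' \<bullet> b = x \<bullet> b" unfolding x'_def by (simp add: inner_add_left)
    then have "plane_refl b (L b) x' = x + (\<Sum>b\<in>insert b B. (2 * (L b - x \<bullet> b)) *\<^sub>R b)"
      unfolding plane_refl_def using insert.hyps by (simp add: x'_def)
    then show ?case
      using L[of b x'] b insert.IH unfolding x'_def by simp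
  qed simp
  have central: "\<phi> (2 *\<^sub>R x0 - x) = \<phi> x" for x
  proof -
    have "x + (\<Sum>b\<in>Basis. (2 * (L b - x \<bullet> b)) *\<^sub>R b) = x + (2 *\<^sub>R x0 - 2 *\<^sub>R (\<Sum>b\<in>Basis. (x \<bullet> b) *\<^sub>R b))"
      unfolding x0_def scaleR_sum_right sum_subtractf[symmetric]
      by (simp add: algebra_simps)
    also have "\<dots> = 2 *\<^sub>R x0 - x" by (simp add: euclidean_representation scaleR_2)
    finally show ?thesis using partial[of Basis x] by simp
  qed
  have centre: "L e = x0 \<bullet> e" if e: "norm e = 1" for e
  proof (rule ccontr)
    assume ne: "L e \<noteq> x0 \<bullet> e"
    define t where "t = (4 * (L e - x0 \<bullet> e)) *\<^sub>R e"
    have "t \<noteq> 0" unfolding t_def using ne e by auto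
    then obtain x where x: "\<phi> (x + t) \<noteq> \<phi> x" using no_trans by blast
    define z where "z = 2 *\<^sub>R x0 - plane_refl e (L e) (2 *\<^sub>R x0 - x)"
    have ee: "e \<bullet> e = 1" using e by (simp add: norm_eq_1)
    have z: "z = x - (2 * (L e - 2 * (x0 \<bullet> e) + x \<bullet> e)) *\<^sub>R e"
      unfolding z_def plane_refl_def by (simp add: inner_diff_left algebra_simps)
    have ze: "z \<bullet> e = - (x \<bullet> e) - 2 * L e + 4 * (x0 \<bullet> e)"
      unfolding z by (simp add: inner_diff_left ee algebra_simps)
    have "plane_refl e (L e) z = x + t"
      unfolding plane_refl_def ze unfolding z t_def by (simp add: algebra_simps flip: scaleR_add_left)
    then have "\<phi> (x + t) = \<phi> z" using L[OF e, of z] by simp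
    also have "\<dots> = \<phi> x" unfolding z_def central L[OF e] ..
    finally show False using x by simp
  qed
  have "\<phi> x = \<phi> y" if "norm (x - x0) = norm (y - x0)" for x y
  proof (cases "x = y")
    case False
    define n where "n = norm (x - y)"
    have n: "n > 0" "n\<^sup>2 = (x - y) \<bullet> (x - y)" unfolding n_def using False by (simp_all add: power2_norm_eq_inner)
    define e where "e = (1 / n) *\<^sub>R (x - y)"
    have e: "norm e = 1" unfolding e_def using n unfolding n_def by simp
    have "(x - x0) \<bullet> (x - x0) = (y - x0) \<bullet> (y - x0)" using that by (simp add: norm_eq)
    then have "2 * ((x0 - x) \<bullet> (x - y)) = - n\<^sup>2"
      unfolding n(2) by (simp add: inner_diff_left inner_diff_right inner_commute algebra_simps)
    then have "2 * ((x0 - x) \<bullet> e) = - n"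
      unfolding e_def inner_scaleR_right using n(1) by (simp add: field_simps power2_eq_square)
    then have "plane_refl e (L e) x = x + (- n) *\<^sub>R e"
      unfolding plane_refl_def centre[OF e] inner_diff_left[symmetric] by simp
    also have "\<dots> = y" unfolding e_def using n by simp
    finally show ?thesis using L[OF e, of x] by simp
  qed simp
  then show ?thesis by blast
qed

lemma radially_symmetric_aboutI:
  assumes "\<And>x y. norm (x - x0) = norm (y - x0) \<Longrightarrow> u x = u y"
  shows "radially_symmetric_about u x0"
  unfolding radially_symmetric_about_def
proof (intro exI allI)
  fix x
  have "norm ((SOME y. norm (y - x0) = norm (x - x0)) - x0) = norm (x - x0)"
    by (rule someI[of "\<lambda>y. norm (y - x0) = norm (x - x0)" x]) simp
  then show "u x = (\<lambda>r. u (SOME y. norm (y - x0) = r)) (norm (x - x0))"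
    using assms[of x "SOME y. norm (y - x0) = norm (x - x0)"] by simp
qed

section \<open>Radial symmetry of decaying solutions\<close>

text \<open>The two summands of the coupling decay like \<open>\<rho>\<close> to the powers \<open>- (a * (p - 1) + b * q)\<close> and
  \<open>- (a * p + b * (q - 1))\<close>; this is where the four quantities in the assumption on the exponents
  come from.\<close>

lemma coupling_decay:
  fixes \<rho> a b p q s t \<beta> :: real
  assumes \<rho>: "\<rho> \<ge> 1" and pq: "p \<ge> 1" "q \<ge> 1" and s: "0 < s" "s \<le> \<rho> powr - a" and t: "0 < t" "t \<le> \<rho> powr - b"
    and \<beta>: "\<beta> \<le> a * (p - 1) + b * q" "\<beta> \<le> a * p + b * (q - 1)"
  shows "coupling p q s t \<le> (p + q) * \<rho> powr - \<beta>"
proof -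
  have mono: "s powr x * t powr y \<le> \<rho> powr - \<beta>" if "x \<ge> 0" "y \<ge> 0" "\<beta> \<le> a * x + b * y" for x y
  proof -
    have "s powr x * t powr y \<le> (\<rho> powr - a) powr x * (\<rho> powr - b) powr y"
      using s t that by (intro mult_mono powr_mono2) auto
    also have "\<dots> = \<rho> powr - (a * x + b * y)"
      by (simp add: powr_powr powr_add[symmetric] algebra_simps)
    also have "\<dots> \<le> \<rho> powr - \<beta>" using that \<rho> by (intro powr_mono) auto
    finally show ?thesis .
  qed
  have "p * (s powr (p - 1) * t powr q) \<le> p * \<rho> powr - \<beta>"
    using pq \<beta> by (intro mult_left_mono mono) auto
  moreover have "q * (s powr p * t powr (q - 1)) \<le> q * \<rho> powr - \<beta>"
    using pq \<beta> by (intro mult_left_mono mono) auto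
  ultimately show ?thesis unfolding coupling_def by (simp add: algebra_simps)
qed

lemma decays_at_infinity_vanish:
  assumes "decays_at_infinity u a" "a > 0" "\<epsilon> > 0"
  shows "\<exists>R. \<forall>x. norm x > R \<longrightarrow> u x < \<epsilon>"
proof -
  obtain R where R: "\<And>x. norm x > R \<Longrightarrow> u x \<le> norm x powr - a"
    using assms(1) unfolding decays_at_infinity_def by blast
  have "((\<lambda>\<rho>::real. \<rho> powr - a) \<longlongrightarrow> 0) at_top"
    using assms(2) by (intro tendsto_neg_powr filterlim_ident) auto
  then have "eventually (\<lambda>\<rho>::real. \<rho> powr - a < \<epsilon>) at_top"
    using assms(3) by (rule order_tendstoD(2))
  then obtain R' where R': "\<And>\<rho>. \<rho> \<ge> R' \<Longrightarrow> \<rho> powr - a < \<epsilon>"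
    unfolding eventually_at_top_linorder by blast
  have "u x < \<epsilon>" if "norm x > max R R'" for x
    using R[of x] R'[of "norm x"] that by force
  then show ?thesis by blast
qed

theorem corollary3:
  fixes N :: nat and C \<alpha> a b :: real
    and pp qq rr ss :: "nat \<Rightarrow> real"
    and p q r s :: real
    and u v :: "real ^ 'n \<Rightarrow> real"
  assumes "N \<ge> 1" and "C > 0" and "0 < \<alpha>" and "\<alpha> < 2"
    and "\<And>i. i \<in> {1..N} \<Longrightarrow> pp i \<ge> 1 \<and> qq i \<ge> 1 \<and> rr i \<ge> 1 \<and> ss i \<ge> 1"
    and "u \<in> L_space \<alpha> \<inter> C11_loc" and "v \<in> L_space \<alpha> \<inter> C11_loc"
    and "\<And>x. frac_laplacian C \<alpha> u x = (\<Sum>i=1..N. u x powr pp i * v x powr qq i)"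
    and "\<And>x. frac_laplacian C \<alpha> v x = (\<Sum>i=1..N. u x powr rr i * v x powr ss i)"
    and "\<And>x. u x > 0" and "\<And>x. v x > 0"
    and "p = Min (pp ` {1..N})" and "q = Min (qq ` {1..N})"
    and "r = Min (rr ` {1..N})" and "s = Min (ss ` {1..N})"
    and "a > 0" and "b > 0"
    and "decays_at_infinity u a" and "decays_at_infinity v b"
    and "\<alpha> < Min {a * p + b * q - a, a * p + b * q - b, a * r + b * s - a, a * r + b * s - b}"
  shows "\<exists>x0. radially_symmetric_about u x0 \<and> radially_symmetric_about v x0"
proof -
  note C = \<open>C > 0\<close> and \<alpha> = \<open>0 < \<alpha>\<close> \<open>\<alpha> < 2\<close>
  note u = \<open>u \<in> L_space \<alpha> \<inter> C11_loc\<close> and v = \<open>v \<in> L_space \<alpha> \<inter> C11_loc\<close>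
  note pos = \<open>\<And>x. u x > 0\<close> \<open>\<And>x. v x > 0\<close>
  note eq_u = assms(8)
  have eq_v: "frac_laplacian C \<alpha> v x = (\<Sum>i=1..N. v x powr ss i * u x powr rr i)" for x
    unfolding assms(9) by (simp add: mult.commute)
  note exps = assms(5)
  have pq1: "\<And>i. i \<in> {1..N} \<Longrightarrow> pp i \<ge> 1 \<and> qq i \<ge> 1" and sr1: "\<And>i. i \<in> {1..N} \<Longrightarrow> ss i \<ge> 1 \<and> rr i \<ge> 1"
    using exps by blast+
  define cu where "cu x = (\<Sum>i=1..N. coupling (pp i) (qq i) (u x) (v x))" for x
  define cv where "cv x = (\<Sum>i=1..N. coupling (ss i) (rr i) (v x) (u x))" for x
  define c where "c x = cu x + cv x" for x
  have c_nonneg: "cu x \<ge> 0" "cv x \<ge> 0" for x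
    unfolding cu_def cv_def using exps by (auto intro!: sum_nonneg coupling_nonneg)
  have cont: "continuous_on UNIV u" "continuous_on UNIV v"
    using frac_laplacian_tendsto(1)[OF \<alpha> u] frac_laplacian_tendsto(1)[OF \<alpha> v]
    unfolding weighted_L1_def by blast+
  have ne: "u x \<noteq> 0" "v x \<noteq> 0" for x using pos[of x] by auto
  have cont_c: "continuous_on UNIV c"
    unfolding c_def cu_def cv_def coupling_def
    by (intro continuous_intros continuous_on_powr cont) (auto simp: ne)
  define \<kappa> where "\<kappa> = C * half_space_const TYPE('n) \<alpha>"
  have \<kappa>: "\<kappa> > 0" unfolding \<kappa>_def by (intro mult_pos_pos C half_space_const_pos)
  define \<beta> where "\<beta> = Min {a * p + b * q - a, a * p + b * q - b, a * r + b * s - a, a * r + b * s - b}"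
  have \<beta>: "\<beta> \<le> a * p + b * q - a" "\<beta> \<le> a * p + b * q - b" "\<beta> \<le> a * r + b * s - a" "\<beta> \<le> a * r + b * s - b"
    unfolding \<beta>_def by (auto intro!: Min_le)
  have \<beta>\<alpha>: "\<alpha> < \<beta>" unfolding \<beta>_def by fact
  have le_exp: "a * p + b * q \<le> a * pp i + b * qq i" "a * r + b * s \<le> a * rr i + b * ss i" if "i \<in> {1..N}" for i
    using that \<open>a > 0\<close> \<open>b > 0\<close> assms(12-15) by (auto intro!: add_mono mult_left_mono Min_le)
  have c_decay: "\<exists>R. \<forall>x. norm x > R \<longrightarrow> (2 * norm x) powr \<alpha> * c x < \<kappa>"
  proof -
    define D where "D = (\<Sum>i=1..N. pp i + qq i) + (\<Sum>i=1..N. ss i + rr i)"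
    obtain R where R: "\<And>x. norm x > R \<Longrightarrow> u x \<le> norm x powr - a"
      using \<open>decays_at_infinity u a\<close> unfolding decays_at_infinity_def by blast
    obtain R' where R': "\<And>x. norm x > R' \<Longrightarrow> v x \<le> norm x powr - b"
      using \<open>decays_at_infinity v b\<close> unfolding decays_at_infinity_def by blast
    have "((\<lambda>\<rho>::real. 2 powr \<alpha> * D * \<rho> powr - (\<beta> - \<alpha>)) \<longlongrightarrow> 2 powr \<alpha> * D * 0) at_top"
      using \<beta>\<alpha> by (intro tendsto_mult_left tendsto_neg_powr filterlim_ident) auto
    then have "eventually (\<lambda>\<rho>::real. 2 powr \<alpha> * D * \<rho> powr - (\<beta> - \<alpha>) < \<kappa>) at_top"
      using \<kappa> by (intro order_tendstoD(2)) auto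
    then obtain R'' where R'': "\<And>\<rho>. \<rho> \<ge> R'' \<Longrightarrow> 2 powr \<alpha> * D * \<rho> powr - (\<beta> - \<alpha>) < \<kappa>"
      unfolding eventually_at_top_linorder by blast
    have "(2 * norm x) powr \<alpha> * c x < \<kappa>" if x: "norm x > max 1 (max R (max R' R''))" for x
    proof -
      have "cu x \<le> (\<Sum>i=1..N. (pp i + qq i) * norm x powr - \<beta>)"
        unfolding cu_def
      proof (rule sum_mono)
        fix i assume i: "i \<in> {1..N}"
        show "coupling (pp i) (qq i) (u x) (v x) \<le> (pp i + qq i) * norm x powr - \<beta>"
          using x R[of x] R'[of x] pos[of x] pq1[OF i] le_exp(1)[OF i] \<beta>
          by (intro coupling_decay[where a = a and b = b]) (auto simp: algebra_simps)
      qed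
      moreover have "cv x \<le> (\<Sum>i=1..N. (ss i + rr i) * norm x powr - \<beta>)"
        unfolding cv_def
      proof (rule sum_mono)
        fix i assume i: "i \<in> {1..N}"
        show "coupling (ss i) (rr i) (v x) (u x) \<le> (ss i + rr i) * norm x powr - \<beta>"
          using x R[of x] R'[of x] pos[of x] sr1[OF i] le_exp(2)[OF i] \<beta>
          by (intro coupling_decay[where a = b and b = a]) (auto simp: algebra_simps)
      qed
      ultimately have "c x \<le> D * norm x powr - \<beta>"
        unfolding c_def D_def by (simp add: sum_distrib_right distrib_right)
      then have "(2 * norm x) powr \<alpha> * c x \<le> (2 * norm x) powr \<alpha> * (D * norm x powr - \<beta>)"
        by (rule mult_left_mono) simp
      also have "\<dots> = 2 powr \<alpha> * D * norm x powr - (\<beta> - \<alpha>)"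
      proof -
        have "(2 * norm x) powr \<alpha> = 2 powr \<alpha> * norm x powr \<alpha>" by (subst powr_mult) auto
        moreover have "norm x powr - (\<beta> - \<alpha>) = norm x powr \<alpha> * norm x powr - \<beta>"
          unfolding powr_add[symmetric] by simp
        ultimately show ?thesis by (simp only: mult_ac)
      qed
      also have "\<dots> < \<kappa>" using x by (intro R'') auto
      finally show ?thesis .
    qed
    then show ?thesis by blast
  qed
  interpret moving_planes u v c \<alpha> \<kappa>
  proof
    show "continuous_on UNIV u" "continuous_on UNIV v" "continuous_on UNIV c"
      by (fact cont cont_c)+
    show "u x > 0" "v x > 0" "c x \<ge> 0" for x
      using pos[of x] c_nonneg[of x] unfolding c_def by auto
    show "\<alpha> > 0" "\<kappa> > 0" by (fact \<alpha>(1) \<kappa>)+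
    show "\<exists>R. \<forall>x. norm x > R \<longrightarrow> u x < \<epsilon> \<and> v x < \<epsilon>" if "\<epsilon> > 0" for \<epsilon>
    proof -
      obtain R R' where "\<And>x. norm x > R \<Longrightarrow> u x < \<epsilon>" "\<And>x. norm x > R' \<Longrightarrow> v x < \<epsilon>"
        using decays_at_infinity_vanish[OF \<open>decays_at_infinity u a\<close> \<open>a > 0\<close> \<open>\<epsilon> > 0\<close>]
          decays_at_infinity_vanish[OF \<open>decays_at_infinity v b\<close> \<open>b > 0\<close> \<open>\<epsilon> > 0\<close>] by blast
      then show ?thesis by (intro exI[of _ "max R R'"]) auto
    qed
    show "\<exists>R. \<forall>x. norm x > R \<longrightarrow> (2 * norm x) powr \<alpha> * c x < \<kappa>" by (fact c_decay)
  next
    fix e x :: "real ^ 'n" and l :: real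
    let ?U = "\<lambda>y. u (plane_refl e l y) - u y" and ?V = "\<lambda>y. v (plane_refl e l y) - v y"
    assume e: "norm e = 1" and x: "x \<bullet> e < l" and neg: "min (?U x) (?V x) < 0"
      and min: "\<And>y. y \<bullet> e < l \<Longrightarrow> min (?U x) (?V x) \<le> min (?U y) (?V y)"
    show "\<kappa> \<le> (l - x \<bullet> e) powr \<alpha> * c x"
    proof (cases "?U x \<le> ?V x")
      case True
      then have "?U x \<le> ?U y" if "y \<bullet> e < l" for y using min[OF that] by simp
      moreover have "?U x < 0" using True neg by simp
      ultimately have "\<kappa> \<le> (l - x \<bullet> e) powr \<alpha> * cu x"
        unfolding \<kappa>_def cu_def
        using coupling_large_at_negative_minimum[OF \<alpha> C u eq_u pq1 pos e x _ _ True] by blast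
      also have "\<dots> \<le> (l - x \<bullet> e) powr \<alpha> * c x"
        unfolding c_def using c_nonneg[of x] by (intro mult_left_mono) auto
      finally show ?thesis .
    next
      case False
      then have le: "?V x \<le> ?U x" by simp
      then have "?V x \<le> ?V y" if "y \<bullet> e < l" for y using min[OF that] by simp
      moreover have "?V x < 0" using le neg by simp
      ultimately have "\<kappa> \<le> (l - x \<bullet> e) powr \<alpha> * cv x"
        unfolding \<kappa>_def cv_def
        using coupling_large_at_negative_minimum[OF \<alpha> C v eq_v sr1 pos(2,1) e x _ _ le] by blast
      also have "\<dots> \<le> (l - x \<bullet> e) powr \<alpha> * c x"
        unfolding c_def using c_nonneg[of x] by (intro mult_left_mono) auto
      finally show ?thesis .
    qed
  next
    fix e x y :: "real ^ 'n" and l :: real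
    assume e: "norm e = 1" and x: "x \<bullet> e < l" and y: "y \<bullet> e < l"
      and ge: "\<And>y. y \<bullet> e < l \<Longrightarrow> u (plane_refl e l y) \<ge> u y \<and> v (plane_refl e l y) \<ge> v y"
      and touch: "u (plane_refl e l x) = u x \<or> v (plane_refl e l x) = v x"
    have ge': "\<And>y. y \<bullet> e < l \<Longrightarrow> u (plane_refl e l y) \<ge> u y"
      "\<And>y. y \<bullet> e < l \<Longrightarrow> v (plane_refl e l y) \<ge> v y" using ge by auto
    from touch show "u (plane_refl e l y) = u y \<and> v (plane_refl e l y) = v y"
    proof
      assume "u (plane_refl e l x) = u x"
      from reflection_rigid[OF \<alpha> C u \<open>N \<ge> 1\<close> eq_u pq1 pos e x ge' this y] show ?thesis by blast
    next
      assume "v (plane_refl e l x) = v x"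
      from reflection_rigid[OF \<alpha> C v \<open>N \<ge> 1\<close> eq_v sr1 pos(2,1) e x ge'(2,1) this y] show ?thesis by blast
    qed
  qed
  have "\<exists>x0. \<forall>x y. norm (x - x0) = norm (y - x0) \<longrightarrow> (u x, v x) = (u y, v y)"
  proof (rule radial_from_symmetric_planes[of "\<lambda>x. (u x, v x)"])
    show "\<exists>l. \<forall>x. (u (plane_refl e l x), v (plane_refl e l x)) = (u x, v x)" if "norm e = 1" for e
      using symmetric_plane[OF that] by simp
    show "\<exists>x. (u (x + t), v (x + t)) \<noteq> (u x, v x)" if "t \<noteq> 0" for t
      using no_translation_invariance[OF that] by auto
  qed
  then show ?thesis by (auto intro!: radially_symmetric_aboutI)
qed

end
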